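(* Let $(\kappa,c)$ be a critical pair. (a) $\widetilde W_-(\eta;\kappa,c)$ is a maximal submodule of $V(\eta;\kappa,c)$. (b) $\widetilde W_+(\eta;\kappa,c)$ is a minimal submodule of $V(\eta;\kappa,c)$. (c) If $n_+=n_-$, then $\widetilde W_+(\eta;\kappa,c)$ is the unique nonzero proper submodule of $V(\eta;\kappa,c)$; in particular $V(\eta;\kappa,c)$ admits a unique composition series $0\subset\widetilde W_+(\eta;\kappa,c)=\widetilde W_-(\eta;\kappa,c)\subset V(\eta;\kappa,c)$. (d) If $n_-<n_+$, then $\widetilde W_+(\eta;\kappa,c)\subset \widetilde W_-(\eta;\kappa,c)$ are the only two nonzero proper submodules of $V(\eta;\kappa,c)$; in particular $V(\eta;\kappa,c)$ admits a unique composition series $0\subset\widetilde W_+(\eta;\kappa,c)\subset \widetilde W_-(\eta;\kappa,c)\subset V(\eta;\kappa,c)$.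
   Context: Let $q\in\mathbb{C}$ be nonzero and not a root of unity, and $U=U_q(\mathfrak{sl}_3)$ the algebra generated by $E_1,E_2,F_1,F_2,K_1^{\pm1},K_2^{\pm1}$ with the Jimbo relations. Put $F_3=F_1F_2-qF_2F_1$, $K=K_1K_2^2$, $C_1=F_1E_1+\frac{qK_1+q^{-1}K_1^{-1}}{(q-q^{-1})^2}$. Let $U^+$ be the subalgebra generated by $E_1,E_2$, $\eta:U^+\to\mathbb{C}$ the algebra homomorphism with $\eta(E_1)=\alpha\neq0$, $\eta(E_2)=0$, and $M(\eta)=U\otimes_{U^+}\mathbb{C}v_\eta$ with $xv_\eta=\eta(x)v_\eta$ for $x\in U^+$. Write $[k]=\frac{q^k-q^{-k}}{q-q^{-1}}$, $[k]!=[k]\cdots[1]$, $[0]!=1$, and $\genfrac{[}{]}{0pt}{}{n}{k}=\frac{[n]!}{[k]![n-k]!}$ for $0\le k\le n$ (0 otherwise). For $n\in\mathbb{Z}_+$, $l\in\mathbb{Z}$, $Q\in\mathbb{C}[K^{\pm1},C_1]$, $u(n,l,Q)=q^{2nl}K_2^l\sum_{k=0}^{n}\sum_{j=0}^{n-k}a_{kj}(n)F_2^{n-k}F_3^kK_2^{2j}K^{-2j-k}Qv_\eta$ with $a_{kj}(n)=(-1)^j\alpha^k(q^2-1)^kq^{j(n-3)}q^{\frac{1}{2}k(2n+2j+k-7)}\genfrac{[}{]}{0pt}{}{n}{k}\genfrac{[}{]}{0pt}{}{n-k}{j}$. For $n\in\mathbb{N}$, $h_n(K,C_1)=q^{3-2n}K+q^{2n-3}K^{-1}-(q-q^{-1})^2C_1$.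 A pair $(\kappa,c)\in\mathbb{C}^2$, $\kappa\ne0$, is critical if $h_n(\kappa,c)=0$ for some $n\in\mathbb{N}$; there are at most two such $n$, and $n_+$, $n_-$ denote the largest and smallest. $J(\kappa,c)$ is the ideal of $\mathbb{C}[K^{\pm1},C_1]$ generated by $K-\kappa$, $C_1-c$; $W(\eta;\kappa,c)=UJ(\kappa,c)v_\eta$, $V(\eta;\kappa,c)=M(\eta)/W(\eta;\kappa,c)$. Set $u_\pm=u(n_\pm,0,1)$, $\bar u_\pm$ its image in $V(\eta;\kappa,c)$, and $\widetilde W_\pm(\eta;\kappa,c)=U\bar u_\pm\subseteq V(\eta;\kappa,c)$. *)

theory Defs
  imports Complex_Main "HOL-Library.Poly_Mapping"
begin

datatype idx = I1 | I2

datatype gen = gE idx | gF idx | gK idx | gKi idx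
  (* gKi i stands for the generator K_i^{-1} *)

datatype word = Wd "gen list"

instantiation word :: monoid_add
begin
definition zero_word :: word where "zero_word = Wd []"
fun plus_word :: "word \<Rightarrow> word \<Rightarrow> word" where
  "plus_word (Wd a) (Wd b) = Wd (a @ b)"
instance
proof
  fix a b c :: word
  show "a + b + c = a + (b + c)" by (cases a; cases b; cases c) simp
  show "0 + a = a" by (cases a) (simp add: zero_word_def)
  show "a + 0 = a" by (cases a) (simp add: zero_word_def)
qed
end

text \<open>Noncommutative polynomials over the complex numbers in the generators
  (convolution product = concatenation of words).\<close>
type_synonym fa = "word \<Rightarrow>\<^sub>0 complex"

definition sc :: "complex \<Rightarrow> fa" where "sc c = Poly_Mapping.single 0 c"
definition gelt :: "gen \<Rightarrow> fa" where "gelt g = Poly_Mapping.single (Wd [g]) 1"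

abbreviation "Eu i \<equiv> gelt (gE i)"
abbreviation "Fu i \<equiv> gelt (gF i)"
abbreviation "Ku i \<equiv> gelt (gK i)"
abbreviation "Kiu i \<equiv> gelt (gKi i)"

fun cartan :: "idx \<Rightarrow> idx \<Rightarrow> int" where
  "cartan I1 I1 = 2" | "cartan I2 I2 = 2" | "cartan I1 I2 = -1" | "cartan I2 I1 = -1"

text \<open>Jimbo relations of U_q(sl_3).\<close>
definition jimbo_rels :: "complex \<Rightarrow> fa set" where
  "jimbo_rels q =
     {Ku i * Kiu i - 1 | i. True} \<union> {Kiu i * Ku i - 1 | i. True}
   \<union> {Ku i * Ku j - Ku j * Ku i | i j. True}
   \<union> {Ku i * Eu j * Kiu i - sc (q powi cartan i j) * Eu j | i j. True}
   \<union> {Ku i * Fu j * Kiu i - sc (q powi (- cartan i j)) * Fu j | i j. True}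
   \<union> {Eu i * Fu j - Fu j * Eu i
        - (if i = j then sc (1 / (q - inverse q)) * (Ku i - Kiu i) else 0) | i j. True}
   \<union> {Eu i * Eu i * Eu j - sc (q + inverse q) * Eu i * Eu j * Eu i + Eu j * Eu i * Eu i
        | i j. i \<noteq> j}
   \<union> {Fu i * Fu i * Fu j - sc (q + inverse q) * Fu i * Fu j * Fu i + Fu j * Fu i * Fu i
        | i j. i \<noteq> j}"

definition left_ideal :: "fa set \<Rightarrow> bool" where
  "left_ideal I \<longleftrightarrow> 0 \<in> I \<and> (\<forall>x\<in>I. \<forall>y\<in>I. x + y \<in> I) \<and> (\<forall>a. \<forall>x\<in>I. a * x \<in> I)"

definition two_sided_ideal :: "fa set \<Rightarrow> bool" where
  "two_sided_ideal I \<longleftrightarrow> left_ideal I \<and> (\<forall>a. \<forall>x\<in>I. x * a \<in> I)"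

definition left_ideal_gen :: "fa set \<Rightarrow> fa set" where
  "left_ideal_gen S = \<Inter>{I. left_ideal I \<and> S \<subseteq> I}"

definition ideal_gen :: "fa set \<Rightarrow> fa set" where
  "ideal_gen S = \<Inter>{I. two_sided_ideal I \<and> S \<subseteq> I}"

text \<open>U = fa / Rel q.\<close>
definition Rel :: "complex \<Rightarrow> fa set" where "Rel q = ideal_gen (jimbo_rels q)"

definition Kel :: fa where "Kel = Ku I1 * Ku I2 ^ 2"
definition Kinvel :: fa where "Kinvel = Kiu I1 * Kiu I2 ^ 2"

definition F3 :: "complex \<Rightarrow> fa" where
  "F3 q = Fu I1 * Fu I2 - sc q * Fu I2 * Fu I1"

definition C1 :: "complex \<Rightarrow> fa" where
  "C1 q = Fu I1 * Eu I1 + sc (q / (q - inverse q)^2) * Ku I1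
          + sc (inverse q / (q - inverse q)^2) * Kiu I1"

definition qint :: "complex \<Rightarrow> nat \<Rightarrow> complex" where
  "qint q k = (q ^ k - inverse q ^ k) / (q - inverse q)"

definition qfact :: "complex \<Rightarrow> nat \<Rightarrow> complex" where
  "qfact q k = (\<Prod>i=1..k. qint q i)"

definition qbinom :: "complex \<Rightarrow> nat \<Rightarrow> nat \<Rightarrow> complex" where
  "qbinom q n k = (if k \<le> n then qfact q n / (qfact q k * qfact q (n - k)) else 0)"

text \<open>a_{kj}(n); the exponent k(2n+2j+k-7)/2 is always an integer.\<close>
definition acoef :: "complex \<Rightarrow> complex \<Rightarrow> nat \<Rightarrow> nat \<Rightarrow> nat \<Rightarrow> complex" where
  "acoef q \<alpha> n k j = (-1) ^ j * \<alpha> ^ k * (q^2 - 1) ^ k * q powi (int j * (int n - 3))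
     * q powi ((int k * (2 * int n + 2 * int j + int k - 7)) div 2)
     * qbinom q n k * qbinom q (n - k) j"

text \<open>u(n,0,1) without the factor v_eta (a lift in the free algebra):
  sum of a_kj(n) F_2^{n-k} F_3^k K_2^{2j} K^{-2j-k}.\<close>
definition uel :: "complex \<Rightarrow> complex \<Rightarrow> nat \<Rightarrow> fa" where
  "uel q \<alpha> n = (\<Sum>k\<in>{0..n}. \<Sum>j\<in>{0..n-k}.
      sc (acoef q \<alpha> n k j) * Fu I2 ^ (n - k) * F3 q ^ k * Ku I2 ^ (2 * j) * Kinvel ^ (2 * j + k))"

text \<open>Annihilator of the generator of V(eta;kappa,c) = M(eta)/U J(kappa,c) v_eta,
  pulled back to the free algebra: generated by the defining relations of U,
  by ker eta (generated as left ideal by E_1 - alpha, E_2) and by K - kappa, C_1 - c.\<close>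
definition Ann :: "complex \<Rightarrow> complex \<Rightarrow> complex \<Rightarrow> complex \<Rightarrow> fa set" where
  "Ann q \<alpha> \<kappa> c = left_ideal_gen
     (Rel q \<union> {Eu I1 - sc \<alpha>, Eu I2, Kel - sc \<kappa>, C1 q - sc c})"

text \<open>Elements of V: classes x v of x in the free algebra.\<close>
definition Vcls :: "complex \<Rightarrow> complex \<Rightarrow> complex \<Rightarrow> complex \<Rightarrow> fa \<Rightarrow> fa set" where
  "Vcls q \<alpha> \<kappa> c x = {y. y - x \<in> Ann q \<alpha> \<kappa> c}"

definition Vset :: "complex \<Rightarrow> complex \<Rightarrow> complex \<Rightarrow> complex \<Rightarrow> fa set set" where
  "Vset q \<alpha> \<kappa> c = range (Vcls q \<alpha> \<kappa> c)"

text \<open>U-submodules of V (the action of a in U, and of complex scalars sc z,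
  is by left multiplication on representatives).\<close>
definition submod :: "complex \<Rightarrow> complex \<Rightarrow> complex \<Rightarrow> complex \<Rightarrow> fa set set \<Rightarrow> bool" where
  "submod q \<alpha> \<kappa> c T \<longleftrightarrow> T \<subseteq> Vset q \<alpha> \<kappa> c \<and> Vcls q \<alpha> \<kappa> c 0 \<in> T
     \<and> (\<forall>x y. Vcls q \<alpha> \<kappa> c x \<in> T \<longrightarrow> Vcls q \<alpha> \<kappa> c y \<in> T \<longrightarrow> Vcls q \<alpha> \<kappa> c (x + y) \<in> T)
     \<and> (\<forall>a x. Vcls q \<alpha> \<kappa> c x \<in> T \<longrightarrow> Vcls q \<alpha> \<kappa> c (a * x) \<in> T)"

definition zero_submod :: "complex \<Rightarrow> complex \<Rightarrow> complex \<Rightarrow> complex \<Rightarrow> fa set set" where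
  "zero_submod q \<alpha> \<kappa> c = {Vcls q \<alpha> \<kappa> c 0}"

definition maximal_submod where
  "maximal_submod q \<alpha> \<kappa> c W \<longleftrightarrow> submod q \<alpha> \<kappa> c W \<and> W \<noteq> Vset q \<alpha> \<kappa> c \<and>
     (\<forall>S. submod q \<alpha> \<kappa> c S \<and> W \<subseteq> S \<longrightarrow> S = W \<or> S = Vset q \<alpha> \<kappa> c)"

definition minimal_submod where
  "minimal_submod q \<alpha> \<kappa> c W \<longleftrightarrow> submod q \<alpha> \<kappa> c W \<and> W \<noteq> zero_submod q \<alpha> \<kappa> c \<and>
     (\<forall>S. submod q \<alpha> \<kappa> c S \<and> S \<subseteq> W \<longrightarrow> S = zero_submod q \<alpha> \<kappa> c \<or> S = W)"

definition hfun :: "complex \<Rightarrow> nat \<Rightarrow> complex \<Rightarrow> complex \<Rightarrow> complex" where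
  "hfun q n \<kappa> c = q powi (3 - 2 * int n) * \<kappa> + q powi (2 * int n - 3) * inverse \<kappa>
                    - (q - inverse q)^2 * c"

definition crit_set :: "complex \<Rightarrow> complex \<Rightarrow> complex \<Rightarrow> nat set" where
  "crit_set q \<kappa> c = {n. n \<ge> 1 \<and> hfun q n \<kappa> c = 0}"

definition critical :: "complex \<Rightarrow> complex \<Rightarrow> complex \<Rightarrow> bool" where
  "critical q \<kappa> c \<longleftrightarrow> \<kappa> \<noteq> 0 \<and> crit_set q \<kappa> c \<noteq> {}"

definition nplus where "nplus q \<kappa> c = Max (crit_set q \<kappa> c)"
definition nminus where "nminus q \<kappa> c = Min (crit_set q \<kappa> c)"

definition Wt :: "complex \<Rightarrow> complex \<Rightarrow> complex \<Rightarrow> complex \<Rightarrow> nat \<Rightarrow> fa set set" where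
  "Wt q \<alpha> \<kappa> c n = {Vcls q \<alpha> \<kappa> c (a * uel q \<alpha> n) | a. True}"

definition Wplus where "Wplus q \<alpha> \<kappa> c = Wt q \<alpha> \<kappa> c (nplus q \<kappa> c)"
definition Wminus where "Wminus q \<alpha> \<kappa> c = Wt q \<alpha> \<kappa> c (nminus q \<kappa> c)"

end

theory Submission
  imports Defs
begin

text \<open>
  On \<open>V\<close> the element \<open>E_1\<close> is diagonalizable with eigenvalues \<open>\<alpha> q^l\<close>, and \<open>K_2\<close> permutes its
  eigenspaces, so everything is governed by the eigenspace for \<open>\<alpha>\<close>. It is stable under \<open>F_2\<close>, \<open>K\<close>, \<open>C_1\<close>
  and under the operators \<open>A_+\<close>, \<open>A_-\<close> with \<open>E_2 = K_2 A_+ + K_2^{-1} A_-\<close>. As \<open>A_-\<close> and \<open>F_2\<close> generate a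
  q-Weyl algebra in which \<open>A_-\<close> is locally nilpotent, the eigenspace has the basis \<open>F_2^a g_b\<close>, where
  \<open>g_b\<close> spans the kernel of \<open>A_-\<close> in degree \<open>b\<close>. One finds \<open>A_+ g_b = [b] h_b(\<kappa>,c) g_{b-1}\<close>.
  Consequently a submodule is the span of the vectors \<open>K_2^l F_2^a g_b\<close> with \<open>b\<close> in some set of
  indices; \<open>F_3\<close> makes this set closed under \<open>b \<mapsto> b + 1\<close>, and \<open>E_2\<close> makes it closed under \<open>b \<mapsto> b - 1\<close>
  unless \<open>b = 0\<close> or \<open>h_b(\<kappa>,c) = 0\<close>. So the proper nonzero submodules are given by \<open>b \<ge> n\<close> for \<open>n\<close> with
  \<open>h_n(\<kappa>,c) = 0\<close>, and \<open>u(n,0,1)\<close> is a nonzero multiple of \<open>g_n\<close>.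
\<close>

section \<open>A model of \<open>V\<close>\<close>

text \<open>The splitting of E_2 into A_+ and A_- is the Serre relation: on an eigenvector of E_1
  with eigenvalue \<lambda> it reads (E_1 - q \<lambda>)(E_1 - q^{-1} \<lambda>) E_2 = 0, so E_2
  changes the exponent of K_2 by 1 or -1. The obstacle is that V is a quotient of a free algebra.
  Rewriting inside it shows only that the monomials F_2^a F_3^b K_2^l span; that none of them
  collapses needs a module in which they are visibly independent. Hence the action is written down
  as operators on coefficient functions, the Jimbo relations are verified for these, and V is
  identified with the orbit of one vector. The factor h_b enters through E_2 F_1 = F_1 E_2, which
  couples A_+ and A_- to C_1. The explicit u(n,0,1) is never tested against A_-. Both it and g_n
  arise, up to scalars, from the generator by applying the same element \<open>Gel\<close> n times,
  which reduces the comparison to a recurrence for q-multinomial coefficients.\<close>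

type_synonym slice = "int \<Rightarrow> int \<Rightarrow> complex"

locale whittaker =
  fixes q \<alpha> \<kappa> c :: complex
  assumes q0: "q \<noteq> 0"
    and qroot: "\<forall>m::nat. m \<ge> 1 \<longrightarrow> q ^ m \<noteq> 1"
    and \<alpha>0: "\<alpha> \<noteq> 0"
    and \<kappa>0: "\<kappa> \<noteq> 0"
begin

definition Q :: "int \<Rightarrow> complex" where "Q n = q powi n"

definition \<delta> :: complex where "\<delta> = q - inverse q"

definition brk :: "int \<Rightarrow> complex" where "brk n = (Q n - 1 / Q n) / \<delta>"

definition hz :: "int \<Rightarrow> complex" where
  "hz b = q^3 * \<kappa> / Q b ^ 2 + Q b ^ 2 / (q^3 * \<kappa>) - \<delta>^2 * c"

definition lo :: "int \<Rightarrow> complex" where "lo b = brk b * hz b"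

text \<open>At a = b = 0 this is \<delta>^2 c, the value of \<delta>^2 C_1 on the generator. The
  last term is the inhomogeneous part accumulated by the recursion in a that \<open>z_x\<close>
  needs.\<close>

definition zdiag :: "int \<Rightarrow> int \<Rightarrow> complex" where
  "zdiag a b = Q a * ((\<delta>^2 * c + q^3 * \<kappa>) / Q b - q^3 * \<kappa> / Q b ^ 3)
     - (Q a - 1 / Q a) * q * \<kappa> / Q b ^ 3"

text \<open>A function of \<open>(a, b)\<close> lists the coefficients of a vector with respect to \<open>F_2^a g_b\<close>. On these,
  \<open>zop\<close> is \<open>(q - q^{-1})^2 C_1\<close>, \<open>xop\<close> is \<open>F_2\<close>, \<open>kop\<close> and \<open>kiop\<close> are \<open>K\<close> and \<open>K^{-1}\<close>,
  \<open>aplus\<close> and \<open>aminus\<close> are \<open>A_+\<close> and \<open>A_-\<close>, and \<open>gone\<close> below is \<open>zop xop - q xop zop\<close>.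
  Letting \<open>a\<close> and \<open>b\<close> range over all integers avoids case distinctions in the relations; the functions
  supported on \<open>a, b \<ge> 0\<close> form a submodule because \<open>brk 0 = lo 0 = 0\<close>.\<close>

definition zop :: "slice \<Rightarrow> slice" where
  "zop \<psi> = (\<lambda>a b. brk (a + 1) * \<psi> (a + 1) (b - 1) + zdiag a b * \<psi> a b
     - \<delta>^2 * q^4 * \<kappa> * Q (a - 1) / Q (b + 1) ^ 3 * lo (b + 1) * \<psi> (a - 1) (b + 1))"

definition xop :: "slice \<Rightarrow> slice" where "xop \<psi> = (\<lambda>a b. \<psi> (a - 1) b)"
definition kop :: "slice \<Rightarrow> slice" where "kop \<psi> = (\<lambda>a b. \<kappa> / (Q a * Q b) ^ 3 * \<psi> a b)"
definition kiop :: "slice \<Rightarrow> slice" where "kiop \<psi> = (\<lambda>a b. (Q a * Q b) ^ 3 / \<kappa> * \<psi> a b)"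
definition aplus :: "slice \<Rightarrow> slice" where
  "aplus \<psi> = (\<lambda>a b. Q a ^ 2 * lo (b + 1) * \<psi> a (b + 1) + Q a * brk (a + 1) / \<delta> * \<psi> (a + 1) b)"
definition aminus :: "slice \<Rightarrow> slice" where
  "aminus \<psi> = (\<lambda>a b. - brk (a + 1) / (Q a * \<delta>) * \<psi> (a + 1) b)"

lemmas slice_ops = zop_def xop_def kop_def kiop_def aplus_def aminus_def

lemma Qs: "Q (n + 1) = Q n * q" "Q (n - 1) = Q n / q" "Q (n + 2) = Q n * q^2" "Q (n - 2) = Q n / q^2"
  using q0 by (simp_all add: Q_def power_int_add power_int_diff)
lemma Q0: "Q n \<noteq> 0" using q0 by (simp add: Q_def)

lemma q2: "q^2 \<noteq> 1" "q * q \<noteq> 1" using qroot[rule_format, of 2] by (simp_all add: power2_eq_square)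
lemma d0: "\<delta> \<noteq> 0" using q2 q0 by (simp add: \<delta>_def field_simps power2_eq_square)
lemma \<delta>_alt: "\<delta> = (q^2 - 1) / q" using q0 by (simp add: \<delta>_def field_simps power2_eq_square)

text \<open>Composing operators leaves iterated shifts in the arguments of \<psi>. Equal arguments
  must become syntactically equal, so that \<open>algebra\<close> can treat the values of \<psi> as
  atoms.\<close>

lemma ishift: "(a::int) - 1 - 1 = a - 2" "a + 1 + 1 = a + 2" "a - 1 + 2 = a + 1" "a + 2 - 1 = a + 1"
  "a + 1 - 2 = a - 1" "a - 2 + 1 = a - 1" "a + 1 - 1 = a" "a - 1 + 1 = a" "a + 2 - 2 = a" "a - 2 + 2 = a"
  "a - 2 - 1 = a - 3" "a - 1 - 2 = a - 3" "a + 2 + 1 = a + 3" "a + 1 + 2 = a + 3" "a + 2 + 2 = a + 4" "a - 2 - 2 = a - 4"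
  "a - 3 + 1 = a - 2" "a + 3 - 1 = a + 2"
  by simp_all

section \<open>Commutation relations of the slice operators\<close>

lemma aplus_x: "aplus (xop \<psi>) a b = q^2 * xop (aplus \<psi>) a b + \<psi> a b / \<delta>"
proof -
  have "(q^2 - 1) \<noteq> 0" using q2 by simp
  then show ?thesis
    using q0 Q0[of a] Q0[of b] by (simp add: slice_ops ishift Qs brk_def \<delta>_alt divide_simps) algebra
qed

lemma aminus_x: "aminus (xop \<psi>) a b = xop (aminus \<psi>) a b / q^2 - \<psi> a b / \<delta>"
proof -
  have "(q^2 - 1) \<noteq> 0" using q2 by simp
  then show ?thesis
    using q0 Q0[of a] Q0[of b] by (simp add: slice_ops ishift Qs brk_def \<delta>_alt divide_simps) algebra
qed

lemma aminus_aplus: "aminus (aplus \<psi>) a b = q^2 * aplus (aminus \<psi>) a b"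
proof -
  have "(q^2 - 1) \<noteq> 0" using q2 by simp
  then show ?thesis
    using q0 Q0[of a] Q0[of b] by (simp add: slice_ops ishift Qs brk_def \<delta>_alt divide_simps) algebra
qed

lemma z_k: "zop (kop \<psi>) a b = kop (zop \<psi>) a b"
  using q0 \<kappa>0 Q0[of a] Q0[of b] by (simp add: slice_ops ishift Qs) (simp add: divide_simps; algebra)
lemma z_ki: "zop (kiop \<psi>) a b = kiop (zop \<psi>) a b"
  using q0 \<kappa>0 Q0[of a] Q0[of b] by (simp add: slice_ops ishift Qs) (simp add: divide_simps; algebra)

definition gone :: "slice \<Rightarrow> slice" where
  "gone \<psi> = (\<lambda>a b. \<psi> a (b - 1) / Q a - q^2 * \<delta> * \<kappa> / (Q a * Q b ^ 3) * \<psi> (a - 1) b)"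

lemma gone_x: "gone (xop \<psi>) a b = xop (gone \<psi>) a b / q"
  using q0 \<kappa>0 Q0[of a] Q0[of b] by (simp add: gone_def slice_ops ishift Qs) (simp add: divide_simps; algebra)

lemma z_x: "zop (xop \<psi>) a b = q * xop (zop \<psi>) a b + gone \<psi> a b"
proof -
  have q1: "q^2 - 1 \<noteq> 0" using q2 by simp
  have 1: "brk (a + 1) = q * brk a + 1 / Q a"
    using q0 q1 Q0[of a] by (simp add: Qs brk_def \<delta>_alt divide_simps; algebra)
  have 2: "zdiag a b = q * zdiag (a - 1) b - q^2 * \<delta> * \<kappa> / (Q a * Q b ^ 3)"
    using q0 q1 Q0[of a] Q0[of b] by (simp add: Qs zdiag_def \<delta>_alt divide_simps; algebra)
  show ?thesis
    using q0 by (simp add: slice_ops gone_def ishift Qs 1 2) (simp add: algebra_simps)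
qed

text \<open>Together with \<open>aplus_z\<close>, the part of E_2 F_1 = F_1 E_2 that involves C_1,
  sorted by the power of K_2.\<close>

lemma aminus_z: "aminus (zop \<psi>) a b = q * zop (aminus \<psi>) a b + q * \<delta> * kop (aplus \<psi>) a b"
proof -
  have q1: "q^2 - 1 \<noteq> 0" using q2 by simp
  show ?thesis
    using q0 q1 Q0[of a] Q0[of b]
    by (simp add: slice_ops ishift Qs brk_def zdiag_def \<delta>_alt) (simp add: divide_simps; algebra)
qed

text \<open>The first relation whose proof opens \<open>lo\<close>: the earlier ones hold with any
  function in its place, while here and in \<open>z_gone\<close> the value [b] h_b is used.\<close>

lemma aplus_z: "aplus (zop \<psi>) a b = zop (aplus \<psi>) a b / q - \<delta> / q * kiop (aminus \<psi>) a b"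
proof -
  have q1: "q^2 - 1 \<noteq> 0" using q2 by simp
  show ?thesis
    using q0 q1 \<kappa>0 Q0[of a] Q0[of b]
    by (simp add: slice_ops ishift Qs brk_def zdiag_def lo_def hz_def \<delta>_alt) (simp add: divide_simps; algebra)
qed

text \<open>With \<open>z_x\<close> this says z^2 x - (q + q^{-1}) z x z + x z^2 = -\<delta>^2 x for
  z = \<open>zop\<close> and x = \<open>xop\<close>. In the Serre relation for F_1, F_1, F_2 the
  right-hand side is cancelled by the cross terms of the K_1 and K_1^{-1} parts of F_1.\<close>

lemma z_gone: "zop (gone \<psi>) a b = gone (zop \<psi>) a b / q - \<delta>^2 * xop \<psi> a b"
proof -
  have q1: "q^2 - 1 \<noteq> 0" using q2 by simp
  show ?thesis
    using q0 q1 \<kappa>0 Q0[of a] Q0[of b]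
    by (simp add: slice_ops gone_def ishift Qs brk_def zdiag_def lo_def hz_def \<delta>_alt) (simp add: divide_simps; algebra)
qed

end

type_synonym vec = "int \<Rightarrow> slice"

context whittaker begin

lemma slice_linear:
  assumes "T \<in> {zop, xop, kop, kiop, aplus, aminus, gone}"
  shows "T (\<lambda>a b. f a b + g a b) = (\<lambda>a b. T f a b + T g a b)"
    and "T (\<lambda>a b. f a b - g a b) = (\<lambda>a b. T f a b - T g a b)"
    and "T (\<lambda>a b. k * f a b) = (\<lambda>a b. k * T f a b)"
    and "T (\<lambda>a b. f a b * k) = (\<lambda>a b. T f a b * k)"
    and "T (\<lambda>a b. f a b / k) = (\<lambda>a b. T f a b / k)"
    and "T (\<lambda>a b. - f a b) = (\<lambda>a b. - T f a b)"
  using assms by (elim insertE emptyE; hypsubst; simp add: slice_ops gone_def fun_eq_iff algebra_simps add_divide_distrib diff_divide_distrib)+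

lemmas slice_lin = slice_linear[where T = zop, simplified] slice_linear[where T = xop, simplified]
  slice_linear[where T = kop, simplified] slice_linear[where T = kiop, simplified]
  slice_linear[where T = aplus, simplified] slice_linear[where T = aminus, simplified]
  slice_linear[where T = gone, simplified]

text \<open>Oriented as rewrite rules towards the order \<open>kop\<close>/\<open>kiop\<close>,
  \<open>xop\<close>, \<open>gone\<close>, \<open>zop\<close>, \<open>aplus\<close>,
  \<open>aminus\<close>. After this normal ordering a relation between generators is an identity
  between rational functions of q and \<open>Q l\<close>.\<close>

lemma slice_comm:
  "zop (kop \<psi>) = kop (zop \<psi>)" "zop (kiop \<psi>) = kiop (zop \<psi>)"
  "kop (kiop \<psi>) = \<psi>" "kiop (kop \<psi>) = \<psi>"
  "xop (kop \<psi>) = (\<lambda>a b. q^3 * kop (xop \<psi>) a b)" "xop (kiop \<psi>) = (\<lambda>a b. kiop (xop \<psi>) a b / q^3)"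
  "aplus (kop \<psi>) = (\<lambda>a b. kop (aplus \<psi>) a b / q^3)" "aplus (kiop \<psi>) = (\<lambda>a b. q^3 * kiop (aplus \<psi>) a b)"
  "aminus (kop \<psi>) = (\<lambda>a b. kop (aminus \<psi>) a b / q^3)" "aminus (kiop \<psi>) = (\<lambda>a b. q^3 * kiop (aminus \<psi>) a b)"
  "aminus (aplus \<psi>) = (\<lambda>a b. q^2 * aplus (aminus \<psi>) a b)"
  "aplus (xop \<psi>) = (\<lambda>a b. q^2 * xop (aplus \<psi>) a b + \<psi> a b / \<delta>)"
  "aminus (xop \<psi>) = (\<lambda>a b. xop (aminus \<psi>) a b / q^2 - \<psi> a b / \<delta>)"
  "aplus (zop \<psi>) = (\<lambda>a b. zop (aplus \<psi>) a b / q - \<delta> / q * kiop (aminus \<psi>) a b)"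
  "aminus (zop \<psi>) = (\<lambda>a b. q * zop (aminus \<psi>) a b + q * \<delta> * kop (aplus \<psi>) a b)"
  "zop (xop \<psi>) = (\<lambda>a b. q * xop (zop \<psi>) a b + gone \<psi> a b)"
  "zop (gone \<psi>) = (\<lambda>a b. gone (zop \<psi>) a b / q - \<delta>^2 * xop \<psi> a b)"
  "gone (xop \<psi>) = (\<lambda>a b. xop (gone \<psi>) a b / q)"
  subgoal by (intro ext z_k)
  subgoal by (intro ext z_ki)
  subgoal using \<kappa>0 by (simp add: slice_ops fun_eq_iff Q0)
  subgoal using \<kappa>0 by (simp add: slice_ops fun_eq_iff Q0)
  subgoal using \<kappa>0 q0 by (simp add: slice_ops fun_eq_iff Q0 Qs field_simps)
  subgoal using \<kappa>0 q0 by (simp add: slice_ops fun_eq_iff Q0 Qs field_simps)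
  subgoal using \<kappa>0 q0 by (simp add: slice_ops fun_eq_iff Q0 Qs divide_simps) (simp add: algebra_simps)
  subgoal using \<kappa>0 q0 by (simp add: slice_ops fun_eq_iff Q0 Qs divide_simps) (simp add: algebra_simps)
  subgoal using \<kappa>0 q0 by (simp add: slice_ops fun_eq_iff Q0 Qs divide_simps)
  subgoal using \<kappa>0 q0 by (simp add: slice_ops fun_eq_iff Q0 Qs divide_simps)
  by (intro ext aminus_aplus aplus_x aminus_x aplus_z aminus_z z_x z_gone gone_x)+

text \<open>The first index \<open>l\<close> is the exponent of \<open>K_2\<close> in \<open>K_2^l F_2^a g_b\<close>. The generator \<open>K_1\<close> acts as
  \<open>K K_2^{-2}\<close>, and \<open>F_1\<close> is obtained from \<open>C_1\<close> by dividing by the eigenvalue of \<open>E_1\<close>.\<close>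

fun gact :: "gen \<Rightarrow> vec \<Rightarrow> vec" where
  "gact (gK I2) \<phi> = (\<lambda>l a b. \<phi> (l - 1) a b)"
| "gact (gKi I2) \<phi> = (\<lambda>l a b. \<phi> (l + 1) a b)"
| "gact (gK I1) \<phi> = (\<lambda>l a b. kop (\<phi> (l + 2)) a b)"
| "gact (gKi I1) \<phi> = (\<lambda>l a b. kiop (\<phi> (l - 2)) a b)"
| "gact (gE I1) \<phi> = (\<lambda>l a b. \<alpha> * Q l * \<phi> l a b)"
| "gact (gF I2) \<phi> = (\<lambda>l a b. Q l ^ 2 * xop (\<phi> l) a b)"
| "gact (gE I2) \<phi> = (\<lambda>l a b. aplus (\<phi> (l - 1)) a b / Q (l - 1) ^ 2 + aminus (\<phi> (l + 1)) a b / Q (l + 1) ^ 2)"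
| "gact (gF I1) \<phi> = (\<lambda>l a b. (zop (\<phi> l) a b / Q l
     - q * kop (\<phi> (l + 2)) a b / Q (l + 2)
     - kiop (\<phi> (l - 2)) a b / (q * Q (l - 2))) / (\<alpha> * \<delta>^2))"

abbreviation "k1 \<equiv> gact (gK I1)" abbreviation "k1i \<equiv> gact (gKi I1)"
abbreviation "k2 \<equiv> gact (gK I2)" abbreviation "k2i \<equiv> gact (gKi I2)"
abbreviation "e1 \<equiv> gact (gE I1)" abbreviation "e2 \<equiv> gact (gE I2)"
abbreviation "f1 \<equiv> gact (gF I1)" abbreviation "f2 \<equiv> gact (gF I2)"

lemma Q4: "Q (n + 4) = Q n * q^4" "Q (n - 4) = Q n / q^4" "Q (n + 3) = Q n * q^3" "Q (n - 3) = Q n / q^3"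
  using q0 by (simp_all add: Q_def power_int_add power_int_diff)

lemma q1: "q^2 - 1 \<noteq> 0" using q2 by simp

section \<open>The Jimbo relations for the operators \<open>gact\<close>\<close>

lemma ef12: "e1 (f2 \<phi>) = f2 (e1 \<phi>)" by (simp add: slice_lin fun_eq_iff)
lemma ef22: "e2 (f2 \<phi>) l a b - f2 (e2 \<phi>) l a b = (k2 \<phi> l a b - k2i \<phi> l a b) / \<delta>"
  using q0 d0 Q0[of l] by (simp add: slice_lin slice_comm Qs ishift divide_simps; algebra)
lemma ef11: "e1 (f1 \<phi>) l a b - f1 (e1 \<phi>) l a b = (k1 \<phi> l a b - k1i \<phi> l a b) / \<delta>"
  using q0 \<alpha>0 q1 Q0[of l] by (simp add: slice_lin slice_comm Qs ishift \<delta>_alt divide_simps; algebra)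
lemma ef21: "e2 (f1 \<phi>) = f1 (e2 \<phi>)"
proof (intro ext)
  fix l a b
  show "e2 (f1 \<phi>) l a b = f1 (e2 \<phi>) l a b"
    using q0 d0 q1 \<alpha>0 Q0[of l] by (simp add: slice_lin slice_comm Qs ishift Q4) (simp add: \<delta>_alt divide_simps; algebra)
qed
lemma e1e1e2: "e1 (e1 (e2 \<phi>)) l a b - (q + inverse q) * e1 (e2 (e1 \<phi>)) l a b + e2 (e1 (e1 \<phi>)) l a b = 0"
  using q0 \<alpha>0 Q0[of l] by (simp add: slice_lin slice_comm Qs ishift divide_simps; algebra)
text \<open>The parts that move the level by 2 or -2 vanish because q and q^{-1} are the roots of
  t^2 - (q + q^{-1}) t + 1. The part that keeps the level is \<open>aminus_aplus\<close>.\<close>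

lemma e2e2e1: "e2 (e2 (e1 \<phi>)) l a b - (q + inverse q) * e2 (e1 (e2 \<phi>)) l a b + e1 (e2 (e2 \<phi>)) l a b = 0"
  using q0 \<alpha>0 Q0[of l] by (simp add: slice_lin slice_comm Qs ishift divide_simps; algebra)
lemma f1f1f2: "f1 (f1 (f2 \<phi>)) l a b - (q + inverse q) * f1 (f2 (f1 \<phi>)) l a b + f2 (f1 (f1 \<phi>)) l a b = 0"
  using q0 \<alpha>0 q1 Q0[of l]
  by (simp add: slice_lin slice_comm Qs Q4 ishift) (simp add: \<delta>_alt divide_simps; algebra)
lemma f2f2f1: "f2 (f2 (f1 \<phi>)) l a b - (q + inverse q) * f2 (f1 (f2 \<phi>)) l a b + f1 (f2 (f2 \<phi>)) l a b = 0"
  using q0 \<alpha>0 q1 Q0[of l]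
  by (simp add: slice_lin slice_comm Qs Q4 ishift) (simp add: \<delta>_alt divide_simps; algebra)

end

section \<open>The action of the free algebra\<close>

lemma fa_induct [case_names single add]:
  fixes x :: fa
  assumes "\<And>w k. P (Poly_Mapping.single w k)" and "\<And>x y. P x \<Longrightarrow> P y \<Longrightarrow> P (x + y)"
  shows "P x"
proof (induction x rule: update_induct)
  case const
  then show ?case using assms(1)[of 0 0] by simp
next
  case (update f a b)
  have "Poly_Mapping.update a b f = f + Poly_Mapping.single a b"
    using update.hyps by (intro poly_mapping_eqI) (auto simp: lookup_update lookup_add lookup_single when_def in_keys_iff)
  then show ?case using assms update by simp
qed

lemma sc_add: "sc (a + b) = sc a + sc b" by (simp add: sc_def single_add)
lemma sc_diff: "sc (a - b) = sc a - sc b" by (simp add: sc_def single_diff)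
lemma sc_uminus: "sc (- a) = - sc a" by (simp add: sc_def single_uminus)
lemma sc_0: "sc 0 = 0" by (simp add: sc_def)
lemma sc_1: "sc 1 = 1" by (simp add: sc_def)
lemma sc_mult: "sc (a * b) = sc a * sc b" by (simp add: sc_def mult_single)
lemma sc_mult_left: "sc a * (sc b * x) = sc (a * b) * x" by (simp add: sc_mult mult.assoc)
lemma sc_central: "x * sc a = sc a * x"
proof (induction x rule: fa_induct)
  case (single w k)
  then show ?case by (simp add: sc_def mult_single mult.commute)
qed (simp add: algebra_simps)
lemma sc_central_left: "x * (sc a * y) = sc a * (x * y)"
  by (metis mult.assoc sc_central)

text \<open>Words are built by prepending letters, so closure under left multiplication by
  generators suffices. This fits left ideals and orbits of a vector.\<close>

lemma fa_closure [case_names one add sc gen]: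
  fixes x :: fa
  assumes 1: "P 1" and add: "\<And>x y. P x \<Longrightarrow> P y \<Longrightarrow> P (x + y)"
    and sc: "\<And>k x. P x \<Longrightarrow> P (sc k * x)" and gen: "\<And>g x. P x \<Longrightarrow> P (gelt g * x)"
  shows "P x"
proof (induction x rule: fa_induct)
  case (single w k)
  obtain gs where w: "w = Wd gs" by (cases w)
  have "P (Poly_Mapping.single (Wd gs) 1)"
  proof (induction gs)
    case Nil
    show ?case using 1 unfolding zero_word_def[symmetric] by simp
  next
    case (Cons g gs)
    then show ?case using gen[of _ g] by (force simp: gelt_def mult_single)
  qed
  from sc[OF this, of k] show ?case by (simp add: w sc_def mult_single zero_word_def)
qed (rule add)

context whittaker begin

fun wact :: "word \<Rightarrow> vec \<Rightarrow> vec" where "wact (Wd gs) \<phi> = foldr gact gs \<phi>"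

definition act :: "fa \<Rightarrow> vec \<Rightarrow> vec" where
  "act x \<phi> = (\<lambda>l a b. \<Sum>w\<in>Poly_Mapping.keys x. Poly_Mapping.lookup x w * wact w \<phi> l a b)"

lemma gact_linear:
  "gact g (\<lambda>l a b. \<phi> l a b + \<psi> l a b) = (\<lambda>l a b. gact g \<phi> l a b + gact g \<psi> l a b)"
  "gact g (\<lambda>l a b. k * \<phi> l a b) = (\<lambda>l a b. k * gact g \<phi> l a b)"
proof (cases "(g, \<phi>)" rule: gact.cases; simp add: slice_lin; simp add: add_divide_distrib diff_divide_distrib algebra_simps)+
qed

lemma wact_linear:
  "wact w (\<lambda>l a b. \<phi> l a b + \<psi> l a b) = (\<lambda>l a b. wact w \<phi> l a b + wact w \<psi> l a b)"
  "wact w (\<lambda>l a b. k * \<phi> l a b) = (\<lambda>l a b. k * wact w \<phi> l a b)"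
proof -
  obtain gs where w: "w = Wd gs" by (cases w)
  show "wact w (\<lambda>l a b. \<phi> l a b + \<psi> l a b) = (\<lambda>l a b. wact w \<phi> l a b + wact w \<psi> l a b)"
    unfolding w by (induction gs) (simp_all add: gact_linear)
  show "wact w (\<lambda>l a b. k * \<phi> l a b) = (\<lambda>l a b. k * wact w \<phi> l a b)"
    unfolding w by (induction gs) (simp_all add: gact_linear)
qed

lemma wact_plus: "wact (u + w) \<phi> = wact u (wact w \<phi>)"
  by (cases u; cases w) simp

lemma act_superset:
  assumes "finite S" "Poly_Mapping.keys x \<subseteq> S"
  shows "act x \<phi> l a b = (\<Sum>w\<in>S. Poly_Mapping.lookup x w * wact w \<phi> l a b)"
  unfolding act_def using assms by (intro sum.mono_neutral_left) (auto simp: in_keys_iff)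

lemma act_add_left: "act (x + y) \<phi> = (\<lambda>l a b. act x \<phi> l a b + act y \<phi> l a b)"
proof (intro ext)
  fix l a b
  let ?S = "Poly_Mapping.keys x \<union> Poly_Mapping.keys y"
  have "Poly_Mapping.keys (x + y) \<subseteq> ?S" by (rule keys_add)
  then show "act (x + y) \<phi> l a b = act x \<phi> l a b + act y \<phi> l a b"
    by (simp add: act_superset[of ?S] lookup_add algebra_simps sum.distrib)
qed

lemma act_single: "act (Poly_Mapping.single w k) \<phi> = (\<lambda>l a b. k * wact w \<phi> l a b)"
  by (intro ext, subst act_superset[of "{w}"]) auto

lemma act_linear:
  "act x (\<lambda>l a b. \<phi> l a b + \<psi> l a b) = (\<lambda>l a b. act x \<phi> l a b + act x \<psi> l a b)"
  "act x (\<lambda>l a b. k * \<phi> l a b) = (\<lambda>l a b. k * act x \<phi> l a b)"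
  by (simp_all add: act_def wact_linear algebra_simps sum.distrib sum_distrib_left)

lemma act_mult: "act (x * y) \<phi> = act x (act y \<phi>)"
proof (induction x rule: fa_induct)
  case (single u k)
  show ?case
  proof (induction y rule: fa_induct)
    case (single w m)
    then show ?case by (simp add: mult_single act_single wact_plus wact_linear mult.assoc)
  next
    case (add x y)
    then show ?case by (simp add: distrib_left act_add_left act_linear)
  qed
next
  case (add x y)
  then show ?case by (simp add: distrib_right act_add_left)
qed

lemma act_sc: "act (sc k) \<phi> = (\<lambda>l a b. k * \<phi> l a b)"
  by (simp add: sc_def act_single zero_word_def)
lemma act_gelt: "act (gelt g) \<phi> = gact g \<phi>"
  by (simp add: gelt_def act_single)
lemma act_1: "act 1 \<phi> = \<phi>" using act_sc[of 1 \<phi>] by (simp add: sc_1)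
lemma act_0: "act 0 \<phi> = (\<lambda>l a b. 0)" by (simp add: act_def)
lemma act_uminus: "act (- x) \<phi> = (\<lambda>l a b. - act x \<phi> l a b)"
proof -
  have "- x = sc (-1) * x" by (simp add: sc_uminus sc_1)
  then show ?thesis by (simp only: act_mult act_sc) simp
qed
lemma act_diff: "act (x - y) \<phi> = (\<lambda>l a b. act x \<phi> l a b - act y \<phi> l a b)"
  using act_add_left[of x "- y" \<phi>] by (simp add: act_uminus)
lemma act_zero: "act x (\<lambda>l a b. 0) = (\<lambda>l a b. 0)"
  using act_linear(2)[of x 0 "\<lambda>l a b. 0"] by simp

lemmas act_simps = act_add_left act_mult act_sc act_gelt act_1 act_0 act_uminus act_diff

lemma act_jimbo: assumes "r \<in> jimbo_rels q" shows "act r \<phi> = (\<lambda>l a b. 0)"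
proof -
  have kk: "k1 (k2 \<phi>) = k2 (k1 \<phi>)" for \<phi> by (simp add: algebra_simps)
  have ii: "(P I1 I1 \<Longrightarrow> P I1 I2 \<Longrightarrow> P I2 I1 \<Longrightarrow> P I2 I2 \<Longrightarrow> P i j)" for P and i j :: idx by (cases i; cases j) simp_all
  have ki: "gact (gK i) (gact (gKi i) \<phi>) = \<phi>" "gact (gKi i) (gact (gK i) \<phi>) = \<phi>" for i \<phi>
    by (cases i; simp add: slice_comm)+
  have kE: "gact (gK i) (gact (gE j) (gact (gKi i) \<phi>)) = (\<lambda>l a b. q powi cartan i j * gact (gE j) \<phi> l a b)" for i j
    by (rule ii[of _ i j]; intro ext; use q0 in \<open>simp add: slice_lin slice_comm Qs ishift; (simp add: divide_simps power_int_minus Q0; algebra?)\<close>)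
  have kF: "gact (gK i) (gact (gF j) (gact (gKi i) \<phi>)) = (\<lambda>l a b. q powi (- cartan i j) * gact (gF j) \<phi> l a b)" for i j
    by (rule ii[of _ i j]; intro ext; use q0 in \<open>simp add: slice_lin slice_comm Qs ishift; (simp add: divide_simps power_int_minus Q0 add.commute[of 2]; algebra?)\<close>)
  have serre: "act (gelt x * gelt x * gelt y - sc (q + inverse q) * gelt x * gelt y * gelt x + gelt y * gelt x * gelt x) \<phi> = (\<lambda>l a b. 0)"
    if "\<And>l a b. gact x (gact x (gact y \<phi>)) l a b - (q + inverse q) * gact x (gact y (gact x \<phi>)) l a b
      + gact y (gact x (gact x \<phi>)) l a b = 0" for x y
    using that by (simp add: act_simps del: gact.simps)
  consider i where "r = Ku i * Kiu i - 1" | i where "r = Kiu i * Ku i - 1"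
    | i j where "r = Ku i * Ku j - Ku j * Ku i"
    | i j where "r = Ku i * Eu j * Kiu i - sc (q powi cartan i j) * Eu j"
    | i j where "r = Ku i * Fu j * Kiu i - sc (q powi (- cartan i j)) * Fu j"
    | i j where "r = Eu i * Fu j - Fu j * Eu i
        - (if i = j then sc (1 / (q - inverse q)) * (Ku i - Kiu i) else 0)"
    | i j where "i \<noteq> j" "r = Eu i * Eu i * Eu j - sc (q + inverse q) * Eu i * Eu j * Eu i + Eu j * Eu i * Eu i"
    | i j where "i \<noteq> j" "r = Fu i * Fu i * Fu j - sc (q + inverse q) * Fu i * Fu j * Fu i + Fu j * Fu i * Fu i"
    using assms unfolding jimbo_rels_def by blast
  then show ?thesis
  proof cases
    case (6 i j)
    have "gact (gE i) (gact (gF j) \<phi>) l a b - gact (gF j) (gact (gE i) \<phi>) l a b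
       = (if i = j then 1 / (q - inverse q) * (gact (gK i) \<phi> l a b - gact (gKi i) \<phi> l a b) else 0)" for l a b
      by (rule ii[of _ i j]) (simp_all add: ef11 ef12 ef21 ef22 flip: \<delta>_def del: gact.simps)
    then show ?thesis unfolding 6 by (simp add: act_simps fun_eq_iff del: gact.simps)
  next
    case (7 i j)
    then show ?thesis by (cases i; cases j; hypsubst; intro serre e1e1e2 e2e2e1) simp_all
  next
    case (8 i j)
    then show ?thesis by (cases i; cases j; hypsubst; intro serre f1f1f2 f2f2f1) simp_all
  next
    case (3 i j)
    then show ?thesis by (cases i; cases j; simp add: act_simps ac_simps)
  qed (simp_all add: act_simps ki kE kF del: gact.simps)
qed

lemma act_Rel: assumes "r \<in> Rel q" shows "act r \<phi> = (\<lambda>l a b. 0)"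
proof -
  have "two_sided_ideal {r. \<forall>\<phi>. act r \<phi> = (\<lambda>l a b. 0)}"
    by (auto simp: two_sided_ideal_def left_ideal_def act_simps act_zero)
  moreover have "jimbo_rels q \<subseteq> {r. \<forall>\<phi>. act r \<phi> = (\<lambda>l a b. 0)}" using act_jimbo by blast
  ultimately show ?thesis using assms unfolding Rel_def ideal_gen_def by blast
qed

definition vac :: vec where "vac = (\<lambda>l a b. if l = 0 \<and> a = 0 \<and> b = 0 then 1 else 0)"

lemma Q_0: "Q 0 = 1" "Q 1 = q" "Q (-1) = 1 / q" "Q 2 = q^2" "Q (-2) = 1 / q^2"
  by (simp_all add: Q_def power_int_minus divide_simps q0)

abbreviation "J \<equiv> Ann q \<alpha> \<kappa> c"

text \<open>Makes the class of x \<mapsto> \<open>act x vac\<close> a well-defined map from V to the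
  model. The clause for C_1 rests on \<open>zdiag 0 0\<close> being \<delta>^2 c, since the K_1 and
  K_1^{-1} parts of F_1 E_1 cancel against those in C_1.\<close>

lemma act_Ann: assumes "r \<in> J" shows "act r vac = (\<lambda>l a b. 0)"
proof -
  have "left_ideal {r. act r vac = (\<lambda>l a b. 0)}"
    by (auto simp: left_ideal_def act_simps act_zero)
  moreover have "Eu I1 - sc \<alpha> \<in> {r. act r vac = (\<lambda>l a b. 0)}"
    by (auto simp: act_simps vac_def Q_0 fun_eq_iff)
  moreover have "Eu I2 \<in> {r. act r vac = (\<lambda>l a b. 0)}"
    by (auto simp: act_simps vac_def Q_0 fun_eq_iff aplus_def aminus_def brk_def lo_def)
  moreover have "Kel - sc \<kappa> \<in> {r. act r vac = (\<lambda>l a b. 0)}"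
    using \<kappa>0 by (auto simp: act_simps Kel_def power2_eq_square vac_def Q_0 fun_eq_iff kop_def)
  moreover have "C1 q - sc c \<in> {r. act r vac = (\<lambda>l a b. 0)}"
    using \<alpha>0 d0 q0 \<kappa>0
    by (auto simp: act_simps C1_def vac_def Q_0 fun_eq_iff kop_def kiop_def zop_def brk_def lo_def simp flip: \<delta>_def)
      (simp_all add: zdiag_def Q_0 divide_simps)
  ultimately show ?thesis using assms act_Rel unfolding Ann_def left_ideal_gen_def by blast
qed

end

section \<open>Commutation relations in \<open>U\<close>\<close>

lemma left_ideal_left_ideal_gen: "left_ideal (left_ideal_gen S)"
  unfolding left_ideal_def left_ideal_gen_def by blast
lemma two_sided_ideal_ideal_gen: "two_sided_ideal (ideal_gen S)"
  unfolding two_sided_ideal_def left_ideal_def ideal_gen_def by blast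

lemma left_ideal_minus: assumes "left_ideal I" "x \<in> I" shows "- x \<in> I"
proof -
  have "(- 1) * x \<in> I" using assms unfolding left_ideal_def by blast
  then show ?thesis by simp
qed

lemmas ring_sc = sc_central[of "gelt _"] sc_central_left[of "gelt _"] sc_mult[symmetric] sc_mult_left distrib_left distrib_right
  right_diff_distrib left_diff_distrib mult.assoc

context whittaker begin

lemma J_ideal: "left_ideal J" unfolding Ann_def by (rule left_ideal_left_ideal_gen)
lemma J_0: "0 \<in> J" using J_ideal unfolding left_ideal_def by blast
lemma J_add: "x \<in> J \<Longrightarrow> y \<in> J \<Longrightarrow> x + y \<in> J" using J_ideal unfolding left_ideal_def by blast
lemma J_mult: "x \<in> J \<Longrightarrow> a * x \<in> J" using J_ideal unfolding left_ideal_def by blast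
lemma J_minus: "x \<in> J \<Longrightarrow> - x \<in> J" using J_ideal left_ideal_minus by blast
lemma J_diff: "x \<in> J \<Longrightarrow> y \<in> J \<Longrightarrow> x - y \<in> J" using J_add J_minus by fastforce
lemma J_sub: "Rel q \<union> {Eu I1 - sc \<alpha>, Eu I2, Kel - sc \<kappa>, C1 q - sc c} \<subseteq> J"
  unfolding Ann_def left_ideal_gen_def by blast
lemma Rel_J: "r \<in> Rel q \<Longrightarrow> r \<in> J" using J_sub by blast

lemma R_ideal: "two_sided_ideal (Rel q)" unfolding Rel_def by (rule two_sided_ideal_ideal_gen)
lemma R_add: "x \<in> Rel q \<Longrightarrow> y \<in> Rel q \<Longrightarrow> x + y \<in> Rel q"
  using R_ideal unfolding two_sided_ideal_def left_ideal_def by blast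
lemma R_left: "x \<in> Rel q \<Longrightarrow> a * x \<in> Rel q"
  using R_ideal unfolding two_sided_ideal_def left_ideal_def by blast
lemma R_right: "x \<in> Rel q \<Longrightarrow> x * a \<in> Rel q"
  using R_ideal unfolding two_sided_ideal_def by blast
lemma R_minus: "x \<in> Rel q \<Longrightarrow> - x \<in> Rel q" using R_left[of x "-1"] by simp
lemma R_diff: "x \<in> Rel q \<Longrightarrow> y \<in> Rel q \<Longrightarrow> x - y \<in> Rel q" using R_add R_minus by fastforce

definition ueq :: "fa \<Rightarrow> fa \<Rightarrow> bool" (infix "\<approx>" 50) where "x \<approx> y \<longleftrightarrow> x - y \<in> Rel q"

lemma ueq_refl: "x \<approx> x" using R_ideal by (simp add: ueq_def two_sided_ideal_def left_ideal_def)
lemma ueq_sym: "x \<approx> y \<Longrightarrow> y \<approx> x" unfolding ueq_def using R_minus by fastforce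
lemma ueq_trans [trans]: "x \<approx> y \<Longrightarrow> y \<approx> z \<Longrightarrow> x \<approx> z"
  unfolding ueq_def using R_add by fastforce
lemma ueq_mult: assumes "x \<approx> y" "z \<approx> w" shows "x * z \<approx> y * w"
proof -
  have "x * z - y * w = (x - y) * z + y * (z - w)" by (simp add: algebra_simps)
  then show ?thesis using assms R_add R_left R_right unfolding ueq_def by metis
qed
lemma ueq_add: "x \<approx> y \<Longrightarrow> z \<approx> w \<Longrightarrow> x + z \<approx> y + w"
  unfolding ueq_def using R_add[of "x - y" "z - w"] by (simp add: algebra_simps)
lemma ueq_diff: "x \<approx> y \<Longrightarrow> z \<approx> w \<Longrightarrow> x - z \<approx> y - w"
  unfolding ueq_def using R_diff[of "x - y" "z - w"] by (simp add: algebra_simps)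

lemma jimbo_Rel: "r \<in> jimbo_rels q \<Longrightarrow> r \<in> Rel q" unfolding Rel_def ideal_gen_def by blast

lemma U_KKi: "Ku i * Kiu i \<approx> 1" "Kiu i * Ku i \<approx> 1"
  unfolding ueq_def by (rule jimbo_Rel; unfold jimbo_rels_def; blast)+
lemma U_KK: "Ku i * Ku j \<approx> Ku j * Ku i"
  unfolding ueq_def by (rule jimbo_Rel; unfold jimbo_rels_def; blast)
lemma U_KEK: "Ku i * Eu j * Kiu i \<approx> sc (q powi cartan i j) * Eu j"
  unfolding ueq_def by (rule jimbo_Rel; unfold jimbo_rels_def; blast)
lemma U_KFK: "Ku i * Fu j * Kiu i \<approx> sc (q powi (- cartan i j)) * Fu j"
  unfolding ueq_def by (rule jimbo_Rel; unfold jimbo_rels_def; blast)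
lemma U_EF: "Eu i * Fu j \<approx> Fu j * Eu i + (if i = j then sc (1 / \<delta>) * (Ku i - Kiu i) else 0)"
proof -
  have "Eu i * Fu j - Fu j * Eu i
        - (if i = j then sc (1 / (q - inverse q)) * (Ku i - Kiu i) else 0) \<in> Rel q"
   by (rule jimbo_Rel; unfold jimbo_rels_def; blast)
  then show ?thesis unfolding ueq_def \<delta>_def by (simp add: algebra_simps)
qed
lemma U_FFF: assumes "i \<noteq> j"
  shows "Fu i * Fu i * Fu j \<approx> sc (q + inverse q) * Fu i * Fu j * Fu i - Fu j * Fu i * Fu i"
proof -
  have "Fu i * Fu i * Fu j - sc (q + inverse q) * Fu i * Fu j * Fu i + Fu j * Fu i * Fu i \<in> Rel q"
   using assms by (intro jimbo_Rel; unfold jimbo_rels_def; blast)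
  then show ?thesis unfolding ueq_def by (simp add: algebra_simps)
qed

lemma conj_comm:
  assumes KK: "k * k' \<approx> 1" "k' * k \<approx> 1" and c: "k * x * k' \<approx> sc s * x" and s: "s \<noteq> 0"
  shows "k * x \<approx> sc s * (x * k)" "k' * x \<approx> sc (1 / s) * (x * k')"
        "x * k \<approx> sc (1 / s) * (k * x)" "x * k' \<approx> sc s * (k' * x)"
proof -
  have "k * x \<approx> k * x * (k' * k)" using ueq_mult[OF ueq_refl[of "k * x"] ueq_sym[OF KK(2)]] by simp
  also have "k * x * (k' * k) = (k * x * k') * k" by (simp add: mult.assoc)
  also have "\<dots> \<approx> (sc s * x) * k" by (intro ueq_mult c ueq_refl)
  finally show 1: "k * x \<approx> sc s * (x * k)" by (simp add: mult.assoc)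
  have "x * k' \<approx> (k' * k) * (x * k')" using ueq_mult[OF ueq_sym[OF KK(2)] ueq_refl[of "x * k'"]] by simp
  also have "(k' * k) * (x * k') = k' * (k * x * k')" by (simp add: mult.assoc)
  also have "\<dots> \<approx> k' * (sc s * x)" by (intro ueq_mult c ueq_refl)
  finally show 2: "x * k' \<approx> sc s * (k' * x)" by (simp add: sc_central_left)
  have "sc (1 / s) * (k * x) \<approx> sc (1 / s) * (sc s * (x * k))" by (intro ueq_mult 1 ueq_refl)
  then show "x * k \<approx> sc (1 / s) * (k * x)" using s by (simp add: sc_mult_left sc_1 ueq_sym)
  have "sc (1 / s) * (x * k') \<approx> sc (1 / s) * (sc s * (k' * x))" by (intro ueq_mult 2 ueq_refl)
  then show "k' * x \<approx> sc (1 / s) * (x * k')" using s by (simp add: sc_mult_left sc_1 ueq_sym)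
qed

lemmas U_KF = conj_comm[OF U_KKi U_KFK] and U_KE = conj_comm[OF U_KKi U_KEK]

lemma U_KKi_comm: "Ku i * Kiu j \<approx> Kiu j * Ku i" "Kiu i * Kiu j \<approx> Kiu j * Kiu i"
proof -
  have c: "Ku j * Ku i * Kiu j \<approx> sc 1 * Ku i" for i j
  proof -
    have "Ku j * Ku i * Kiu j \<approx> Ku i * Ku j * Kiu j" by (intro ueq_mult U_KK ueq_refl)
    also have "Ku i * Ku j * Kiu j = Ku i * (Ku j * Kiu j)" by (simp add: mult.assoc)
    also have "\<dots> \<approx> Ku i * 1" by (intro ueq_mult U_KKi ueq_refl)
    finally show ?thesis by (simp add: sc_1)
  qed
  show 1: "Ku i * Kiu j \<approx> Kiu j * Ku i" for i j
    using conj_comm(4)[OF U_KKi c] by (simp add: sc_1)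
  have c: "Ku i * Kiu j * Kiu i \<approx> sc 1 * Kiu j"
  proof -
    have "Ku i * Kiu j * Kiu i \<approx> Kiu j * Ku i * Kiu i" by (intro ueq_mult 1 ueq_refl)
    also have "Kiu j * Ku i * Kiu i = Kiu j * (Ku i * Kiu i)" by (simp add: mult.assoc)
    also have "\<dots> \<approx> Kiu j * 1" by (intro ueq_mult U_KKi ueq_refl)
    finally show ?thesis by (simp add: sc_1)
  qed
  show "Kiu i * Kiu j \<approx> Kiu j * Kiu i"
    using conj_comm(2)[OF U_KKi c] by (simp add: sc_1)
qed

abbreviation "Fu3 \<equiv> F3 q"

lemma U_KF3K: "Ku i * Fu3 * Kiu i \<approx> sc (1 / q) * Fu3"
proof -
  have KFF: "Ku i * (Fu j * Fu k) * Kiu i \<approx> sc (1 / q) * (Fu j * Fu k)" if "j \<noteq> k" for j k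
  proof -
    have e: "q powi (- cartan i j) * q powi (- cartan i k) = 1 / q"
      using that q0 by (cases i; cases j; cases k) (simp_all add: power_int_minus divide_simps power2_eq_square)
    have "Ku i * (Fu j * Fu k) * Kiu i \<approx> Ku i * (Fu j * 1 * Fu k) * Kiu i" by (simp add: ueq_refl)
    also have "\<dots> \<approx> Ku i * (Fu j * (Kiu i * Ku i) * Fu k) * Kiu i" by (intro ueq_mult ueq_refl U_KKi[THEN ueq_sym])
    also have "\<dots> = (Ku i * Fu j * Kiu i) * (Ku i * Fu k * Kiu i)" by (simp add: mult.assoc)
    also have "\<dots> \<approx> (sc (q powi (- cartan i j)) * Fu j) * (sc (q powi (- cartan i k)) * Fu k)"
      by (intro ueq_mult U_KFK)
    also have "\<dots> = sc (1 / q) * (Fu j * Fu k)"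
      by (simp add: ring_sc e)
    finally show ?thesis .
  qed
  have "Ku i * Fu3 * Kiu i = Ku i * (Fu I1 * Fu I2) * Kiu i - sc q * (Ku i * (Fu I2 * Fu I1) * Kiu i)"
    by (simp add: F3_def ring_sc)
  also have "\<dots> \<approx> sc (1 / q) * (Fu I1 * Fu I2) - sc q * (sc (1 / q) * (Fu I2 * Fu I1))"
    by (intro ueq_diff ueq_mult ueq_refl KFF) simp_all
  also have "\<dots> = sc (1 / q) * Fu3" by (simp add: F3_def ring_sc mult.commute)
  finally show ?thesis .
qed

lemmas U_KF3 = conj_comm[OF U_KKi U_KF3K]

text \<open>The cubic Serre relation for F_1, F_1, F_2 is a q-commutation between F_1 and the
  q-commutator F_3; \<open>U_F3F2\<close> is the other one.\<close>

lemma U_F1F3: "Fu I1 * Fu3 \<approx> sc (1 / q) * (Fu3 * Fu I1)"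
proof -
  have "Fu I1 * Fu3 = Fu I1 * Fu I1 * Fu I2 - sc q * (Fu I1 * Fu I2 * Fu I1)"
    by (simp add: F3_def ring_sc)
  also have "\<dots> \<approx> (sc (q + inverse q) * Fu I1 * Fu I2 * Fu I1 - Fu I2 * Fu I1 * Fu I1) - sc q * (Fu I1 * Fu I2 * Fu I1)"
    by (intro ueq_diff ueq_refl U_FFF) simp
  also have "\<dots> = sc (1 / q) * (Fu3 * Fu I1)"
    using q0 by (simp add: F3_def ring_sc sc_add sc_1 inverse_eq_divide)
  finally show ?thesis .
qed

lemma U_F3F2: "Fu3 * Fu I2 \<approx> sc (1 / q) * (Fu I2 * Fu3)"
proof -
  \<comment> \<open>The difference is literally the Serre relator, already in the free
    algebra.\<close>
  have "Fu3 * Fu I2 - sc (1 / q) * (Fu I2 * Fu3) =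
     Fu I2 * Fu I2 * Fu I1 - (sc (q + inverse q) * Fu I2 * Fu I1 * Fu I2 - Fu I1 * Fu I2 * Fu I2)"
    using q0 by (simp add: F3_def ring_sc sc_add sc_1 inverse_eq_divide)
  then show ?thesis using U_FFF[of I2 I1] by (simp add: ueq_def)
qed

lemma U_E1F3: "Eu I1 * Fu3 \<approx> Fu3 * Eu I1 + Fu I2 * Kiu I1"
proof -
  let ?h = "sc (1 / \<delta>) * (Ku I1 - Kiu I1)"
  have 11: "Eu I1 * Fu I1 \<approx> Fu I1 * Eu I1 + ?h" using U_EF[of I1 I1] by simp
  have 12: "Eu I1 * Fu I2 \<approx> Fu I2 * Eu I1" using U_EF[of I1 I2] by simp
  have k: "Ku I1 * Fu I2 \<approx> sc q * (Fu I2 * Ku I1)" "Kiu I1 * Fu I2 \<approx> sc (1 / q) * (Fu I2 * Kiu I1)"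
    using U_KF(1,2)[of I1 I2] q0 by simp_all
  have "Eu I1 * Fu3 = (Eu I1 * Fu I1) * Fu I2 - sc q * (Eu I1 * Fu I2) * Fu I1"
    by (simp add: F3_def ring_sc)
  also have "\<dots> \<approx> (Fu I1 * Eu I1 + ?h) * Fu I2 - sc q * (Fu I2 * Eu I1) * Fu I1"
    by (intro ueq_diff ueq_mult 11 12 ueq_refl)
  also have "\<dots> = Fu I1 * (Eu I1 * Fu I2) + sc (1 / \<delta>) * (Ku I1 * Fu I2 - Kiu I1 * Fu I2) - sc q * (Fu I2 * (Eu I1 * Fu I1))"
    by (simp add: ring_sc)
  also have "\<dots> \<approx> Fu I1 * (Fu I2 * Eu I1) + sc (1 / \<delta>) * (sc q * (Fu I2 * Ku I1) - sc (1 / q) * (Fu I2 * Kiu I1)) - sc q * (Fu I2 * (Fu I1 * Eu I1 + ?h))"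
    by (intro ueq_diff ueq_add ueq_mult 11 12 k ueq_refl)
  \<comment> \<open>The two K_1 terms cancel; the K_1^{-1} terms have coefficients q / \<delta> and
    -q^{-1} / \<delta>, which add up to 1.\<close>
  also have "\<dots> = Fu3 * Eu I1 + sc ((q - 1 / q) / \<delta>) * (Fu I2 * Kiu I1)"
    by (simp add: F3_def ring_sc diff_divide_distrib sc_diff mult.commute)
  also have "(q - 1 / q) / \<delta> = 1" using d0 by (simp add: \<delta>_def inverse_eq_divide)
  finally show ?thesis by (simp add: sc_1)
qed

lemma U_E2F3: "Eu I2 * Fu3 \<approx> Fu3 * Eu I2 - sc q * (Fu I1 * Ku I2)"
proof -
  let ?h = "sc (1 / \<delta>) * (Ku I2 - Kiu I2)"
  have 11: "Eu I2 * Fu I2 \<approx> Fu I2 * Eu I2 + ?h" using U_EF[of I2 I2] by simp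
  have 12: "Eu I2 * Fu I1 \<approx> Fu I1 * Eu I2" using U_EF[of I2 I1] by simp
  have k: "Ku I2 * Fu I1 \<approx> sc q * (Fu I1 * Ku I2)" "Kiu I2 * Fu I1 \<approx> sc (1 / q) * (Fu I1 * Kiu I2)"
    using U_KF(1,2)[of I2 I1] q0 by simp_all
  have "Eu I2 * Fu3 = (Eu I2 * Fu I1) * Fu I2 - sc q * ((Eu I2 * Fu I2) * Fu I1)"
    by (simp add: F3_def ring_sc)
  also have "\<dots> \<approx> (Fu I1 * Eu I2) * Fu I2 - sc q * ((Fu I2 * Eu I2 + ?h) * Fu I1)"
    by (intro ueq_diff ueq_mult 11 12 ueq_refl)
  also have "\<dots> = Fu I1 * (Eu I2 * Fu I2) - sc q * (sc (1 / \<delta>) * (Ku I2 * Fu I1 - Kiu I2 * Fu I1)) - sc q * (Fu I2 * (Eu I2 * Fu I1))"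
    by (simp add: ring_sc)
  also have "\<dots> \<approx> Fu I1 * (Fu I2 * Eu I2 + ?h) - sc q * (sc (1 / \<delta>) * (sc q * (Fu I1 * Ku I2) - sc (1 / q) * (Fu I1 * Kiu I2))) - sc q * (Fu I2 * (Fu I1 * Eu I2))"
    by (intro ueq_diff ueq_add ueq_mult 11 12 k ueq_refl)
  also have "\<dots> = Fu3 * Eu I2 - sc ((q * q - 1) / \<delta>) * (Fu I1 * Ku I2)"
    using q0 by (simp add: F3_def ring_sc diff_divide_distrib sc_diff mult.commute)
  also have "(q * q - 1) / \<delta> = q" using d0 q0 by (simp add: \<delta>_def field_simps)
  finally show ?thesis .
qed

end

section \<open>A spanning set of \<open>V\<close>\<close>

context whittaker begin

lemma ueq_right: "x \<approx> y \<Longrightarrow> x * z \<approx> y * z" by (intro ueq_mult ueq_refl)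
lemma ueq_left: "x \<approx> y \<Longrightarrow> z * x \<approx> z * y" by (intro ueq_mult ueq_refl)

text \<open>For a spanning statement only the order of the factors matters, so the scalars are
  hidden behind existentials and one rule, \<open>SP_comm\<close>, serves all these pairs.\<close>

lemma scale_comm:
  "\<exists>s. Ku i * Fu j \<approx> sc s * (Fu j * Ku i)" "\<exists>s. Kiu i * Fu j \<approx> sc s * (Fu j * Kiu i)"
  "\<exists>s. Fu j * Ku i \<approx> sc s * (Ku i * Fu j)" "\<exists>s. Fu j * Kiu i \<approx> sc s * (Kiu i * Fu j)"
  "\<exists>s. Eu j * Ku i \<approx> sc s * (Ku i * Eu j)" "\<exists>s. Eu j * Kiu i \<approx> sc s * (Kiu i * Eu j)"
  "\<exists>s. Ku i * Fu3 \<approx> sc s * (Fu3 * Ku i)" "\<exists>s. Kiu i * Fu3 \<approx> sc s * (Fu3 * Kiu i)"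
  "\<exists>s. Ku i * Ku j \<approx> sc s * (Ku j * Ku i)" "\<exists>s. Kiu i * Kiu j \<approx> sc s * (Kiu j * Kiu i)"
  "\<exists>s. Ku i * Kiu j \<approx> sc s * (Kiu j * Ku i)" "\<exists>s. Kiu i * Ku j \<approx> sc s * (Ku j * Kiu i)"
proof -
  have nz: "q powi n \<noteq> 0" "1 / q \<noteq> 0" for n using q0 by simp_all
  have 1: "\<exists>s. x \<approx> sc s * y" if "x \<approx> y" for x y
    using that by (intro exI[of _ 1]) (simp add: sc_1)
  show "\<exists>s. Ku i * Fu j \<approx> sc s * (Fu j * Ku i)" "\<exists>s. Kiu i * Fu j \<approx> sc s * (Fu j * Kiu i)"
    "\<exists>s. Fu j * Ku i \<approx> sc s * (Ku i * Fu j)" "\<exists>s. Fu j * Kiu i \<approx> sc s * (Kiu i * Fu j)"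
    using U_KF[OF nz(1)] by blast+
  show "\<exists>s. Eu j * Ku i \<approx> sc s * (Ku i * Eu j)" "\<exists>s. Eu j * Kiu i \<approx> sc s * (Kiu i * Eu j)"
    using U_KE[OF nz(1)] by blast+
  show "\<exists>s. Ku i * Fu3 \<approx> sc s * (Fu3 * Ku i)" "\<exists>s. Kiu i * Fu3 \<approx> sc s * (Fu3 * Kiu i)"
    using U_KF3[OF nz(2)] by blast+
  show "\<exists>s. Ku i * Ku j \<approx> sc s * (Ku j * Ku i)" "\<exists>s. Kiu i * Kiu j \<approx> sc s * (Kiu j * Kiu i)"
    "\<exists>s. Ku i * Kiu j \<approx> sc s * (Kiu j * Ku i)" "\<exists>s. Kiu i * Ku j \<approx> sc s * (Ku j * Kiu i)"
    by (intro 1 U_KK U_KKi_comm U_KKi_comm(1)[THEN ueq_sym])+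
qed

text \<open>The elements whose classes are reached from the generator of V by F_2, F_3 and K_2,
  K_2^{-1}. Closure under the remaining generators will show that this is everything; J is included
  so that elements may be replaced modulo J.\<close>

inductive_set SP :: "fa set" where
  J: "x \<in> J \<Longrightarrow> x \<in> SP"
| one: "1 \<in> SP"
| add: "x \<in> SP \<Longrightarrow> y \<in> SP \<Longrightarrow> x + y \<in> SP"
| sc: "x \<in> SP \<Longrightarrow> sc k * x \<in> SP"
| F2: "x \<in> SP \<Longrightarrow> Fu I2 * x \<in> SP"
| F3: "x \<in> SP \<Longrightarrow> Fu3 * x \<in> SP"
| K2: "x \<in> SP \<Longrightarrow> Ku I2 * x \<in> SP"
| K2i: "x \<in> SP \<Longrightarrow> Kiu I2 * x \<in> SP"

lemma SP_uminus: "x \<in> SP \<Longrightarrow> - x \<in> SP"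
  using SP.sc[of x "-1"] by (simp add: sc_uminus sc_1)
lemma SP_diff: "x \<in> SP \<Longrightarrow> y \<in> SP \<Longrightarrow> x - y \<in> SP"
  using SP.add[of x "- y"] SP_uminus by simp
lemma SP_J: "x - y \<in> J \<Longrightarrow> y \<in> SP \<Longrightarrow> x \<in> SP"
  using SP.add[OF SP.J, of "x - y" y] by simp
lemma SP_ueq: "x \<approx> y \<Longrightarrow> y \<in> SP \<Longrightarrow> x \<in> SP"
  using SP_J Rel_J by (auto simp: ueq_def)

text \<open>Induction on x: the assumption on g alone settles x = 1, and what remains is to move g
  past one further letter.\<close>

lemma SP_closed:
  assumes base: "g \<in> SP"
    and step: "\<And>h x. h \<in> {Fu I2, Fu3, Ku I2, Kiu I2} \<Longrightarrow> x \<in> SP \<Longrightarrow> g * x \<in> SP \<Longrightarrow> g * h * x \<in> SP"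
    and x: "x \<in> SP"
  shows "g * x \<in> SP"
  using x
proof induction
  case (sc x k)
  then show ?case by (simp add: sc_central_left SP.sc)
qed (use step base in \<open>auto simp: distrib_left mult.assoc J_mult intro: SP.J SP.add\<close>)

lemma SP_comm:
  assumes base: "g \<in> SP"
    and step: "\<And>h. h \<in> {Fu I2, Fu3, Ku I2, Kiu I2} \<Longrightarrow> \<exists>s. g * h \<approx> sc s * (h * g)"
    and x: "x \<in> SP"
  shows "g * x \<in> SP"
proof (rule SP_closed[OF base _ x])
  fix h x assume h: "h \<in> {Fu I2, Fu3, Ku I2, Kiu I2}" and x: "x \<in> SP" "g * x \<in> SP"
  obtain s where "g * h \<approx> sc s * (h * g)" using step h by blast
  then have "g * h * x \<approx> sc s * (h * g) * x" by (rule ueq_right)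
  moreover have "h * (g * x) \<in> SP" using h x SP.F2 SP.F3 SP.K2 SP.K2i by blast
  ultimately show "g * h * x \<in> SP" by (auto simp: mult.assoc intro: SP_ueq SP.sc)
qed

text \<open>On the generator K is the scalar \<kappa>, so K_1 becomes \<kappa> K_2^{-2} and K_1^{-1}
  becomes \<kappa>^{-1} K_2^2. Both then q-commute past the letters of \<open>SP\<close>.\<close>

lemma SP_K1: "x \<in> SP \<Longrightarrow> Ku I1 * x \<in> SP" and SP_K1i: "x \<in> SP \<Longrightarrow> Kiu I1 * x \<in> SP"
proof -
  have kj: "Kel - sc \<kappa> \<in> J" using J_sub by simp
  have "Kiu I2 * (Kiu I2 * Kel) \<approx> Ku I1"
  proof -
    have "Kiu I2 * (Kiu I2 * Kel) = Kiu I2 * ((Kiu I2 * Ku I1) * Ku I2) * Ku I2"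
      by (simp add: Kel_def power2_eq_square mult.assoc)
    also have "\<dots> \<approx> Kiu I2 * ((Ku I1 * Kiu I2) * Ku I2) * Ku I2"
      by (intro ueq_mult ueq_refl U_KKi_comm[THEN ueq_sym])
    also have "\<dots> = Kiu I2 * (Ku I1 * (Kiu I2 * Ku I2)) * Ku I2"
      by (simp add: mult.assoc)
    also have "\<dots> \<approx> Kiu I2 * (Ku I1 * 1) * Ku I2"
      by (intro ueq_mult ueq_refl U_KKi)
    also have "\<dots> \<approx> (Ku I1 * Kiu I2) * Ku I2"
      using U_KKi_comm(1)[of I1 I2, THEN ueq_sym] by (simp add: ueq_right)
    also have "\<dots> = Ku I1 * (Kiu I2 * Ku I2)" by (simp add: mult.assoc)
    also have "\<dots> \<approx> Ku I1 * 1" by (intro ueq_mult ueq_refl U_KKi)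
    finally show ?thesis by simp
  qed
  moreover have "Kiu I2 * (Kiu I2 * Kel) \<in> SP"
  proof (rule SP_J)
    show "Kiu I2 * (Kiu I2 * Kel) - Kiu I2 * (Kiu I2 * (sc \<kappa> * 1)) \<in> J"
      using J_mult[OF J_mult[OF kj]] by (simp add: right_diff_distrib)
    show "Kiu I2 * (Kiu I2 * (sc \<kappa> * 1)) \<in> SP" by (intro SP.intros)
  qed
  ultimately have b1: "Ku I1 \<in> SP" using SP_ueq ueq_sym by blast
  have "Kiu I1 * Kel = (Kiu I1 * Ku I1) * (Ku I2 * (Ku I2 * 1))"
    by (simp add: Kel_def power2_eq_square mult.assoc)
  also have "\<dots> \<approx> 1 * (Ku I2 * (Ku I2 * 1))" by (intro ueq_mult ueq_refl U_KKi)
  finally have "Kiu I1 * Kel \<in> SP" by (rule SP_ueq) (simp add: SP.one SP.K2 SP.K2[OF SP.K2[OF SP.one], simplified])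
  moreover have "Kiu I1 * sc \<kappa> - Kiu I1 * Kel \<in> J"
    using J_minus[OF J_mult[OF kj, of "Kiu I1"]] by (simp add: right_diff_distrib)
  ultimately have "Kiu I1 * sc \<kappa> \<in> SP" by (rule SP_J[rotated])
  then have "sc (1 / \<kappa>) * (Kiu I1 * sc \<kappa>) \<in> SP" by (rule SP.sc)
  then have b2: "Kiu I1 \<in> SP" using \<kappa>0 by (simp add: sc_central sc_mult_left sc_1)
  show "x \<in> SP \<Longrightarrow> Ku I1 * x \<in> SP"
    by (rule SP_comm[OF b1]) (auto intro: scale_comm)
  show "x \<in> SP \<Longrightarrow> Kiu I1 * x \<in> SP"
    by (rule SP_comm[OF b2]) (auto intro: scale_comm)
qed

lemma SP_E1: "x \<in> SP \<Longrightarrow> Eu I1 * x \<in> SP"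
proof (rule SP_closed)
  have "Eu I1 - sc \<alpha> * 1 \<in> J" using J_sub by simp
  then show "Eu I1 \<in> SP" by (rule SP_J) (intro SP.intros)
  fix h x assume h: "h \<in> {Fu I2, Fu3, Ku I2, Kiu I2}" and x: "x \<in> SP" "Eu I1 * x \<in> SP"
  consider (f2) "h = Fu I2" | (f3) "h = Fu3" | (k) "h = Ku I2 \<or> h = Kiu I2"
    using h by blast
  then show "Eu I1 * h * x \<in> SP"
  proof cases
    case f2
    have "Eu I1 * Fu I2 * x \<approx> Fu I2 * Eu I1 * x" using U_EF[of I1 I2] by (auto intro!: ueq_mult ueq_refl)
    then show ?thesis unfolding f2 by (rule SP_ueq) (simp add: mult.assoc SP.F2 x)
  next
    case f3
    have "Eu I1 * Fu3 * x \<approx> (Fu3 * Eu I1 + Fu I2 * Kiu I1) * x" by (intro ueq_mult ueq_refl U_E1F3)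
    then show ?thesis unfolding f3
      by (rule SP_ueq) (simp add: distrib_right mult.assoc SP.F2 SP.F3 SP.add SP_K1i x)
  next
    case k
    then have "\<exists>s. Eu I1 * h \<approx> sc s * (h * Eu I1)" by (elim disjE; hypsubst; intro scale_comm)
    then obtain s where "Eu I1 * h \<approx> sc s * (h * Eu I1)" by blast
    then have "Eu I1 * h * x \<approx> sc s * (h * Eu I1) * x" by (rule ueq_right)
    then show ?thesis using k by (elim SP_ueq) (auto simp add: mult.assoc SP.K2 SP.K2i SP.sc x)
  qed
qed

text \<open>On the generator F_1 E_1 is \<alpha> F_1, while C_1 = c expresses F_1 E_1 through K_1
  and K_1^{-1}; dividing by \<alpha> settles the base case. Moving F_1 past F_2 produces F_3, which
  is why F_3 is among the letters.\<close>

lemma SP_F1: "x \<in> SP \<Longrightarrow> Fu I1 * x \<in> SP"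
proof (rule SP_closed)
  have e: "Eu I1 - sc \<alpha> \<in> J" and c: "C1 q - sc c \<in> J" using J_sub by simp_all
  have "Fu I1 * Eu I1 - (sc c * 1 - sc (q / (q - inverse q)^2) * (Ku I1 * 1)
      - sc (inverse q / (q - inverse q)^2) * (Kiu I1 * 1)) \<in> J" (is "_ - ?r \<in> J")
    using c by (simp add: C1_def algebra_simps)
  then have "Fu I1 * Eu I1 \<in> SP" by (rule SP_J) (intro SP.intros SP_diff SP_K1 SP_K1i)
  moreover have "Fu I1 * sc \<alpha> - Fu I1 * Eu I1 \<in> J"
    using J_minus[OF J_mult[OF e, of "Fu I1"]] by (simp add: right_diff_distrib)
  ultimately have "Fu I1 * sc \<alpha> \<in> SP" by (rule SP_J[rotated])
  then have "sc (1 / \<alpha>) * (Fu I1 * sc \<alpha>) \<in> SP" by (rule SP.sc)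
  then show "Fu I1 \<in> SP" using \<alpha>0 by (simp add: sc_central sc_mult_left sc_1)
  fix h x assume h: "h \<in> {Fu I2, Fu3, Ku I2, Kiu I2}" and x: "x \<in> SP" "Fu I1 * x \<in> SP"
  consider (f2) "h = Fu I2" | (k) "h = Fu3 \<or> h = Ku I2 \<or> h = Kiu I2"
    using h by blast
  then show "Fu I1 * h * x \<in> SP"
  proof cases
    case f2
    have "Fu I1 * Fu I2 * x = Fu3 * x + sc q * (Fu I2 * (Fu I1 * x))"
      by (simp add: F3_def algebra_simps)
    then show ?thesis unfolding f2 by (simp add: SP.intros x)
  next
    case k
    then have "\<exists>s. Fu I1 * h \<approx> sc s * (h * Fu I1)"
      by (elim disjE; hypsubst; intro scale_comm exI[of _ "1 / q"] U_F1F3)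
    then obtain s where "Fu I1 * h \<approx> sc s * (h * Fu I1)" by blast
    then have "Fu I1 * h * x \<approx> sc s * (h * Fu I1) * x" by (rule ueq_right)
    then show ?thesis using k by (elim SP_ueq) (auto simp add: mult.assoc SP.F3 SP.K2 SP.K2i SP.sc x)
  qed
qed

text \<open>E_2 F_3 produces a term with F_1, so closure under F_1 must be known before.\<close>

lemma SP_E2: "x \<in> SP \<Longrightarrow> Eu I2 * x \<in> SP"
proof (rule SP_closed)
  show "Eu I2 \<in> SP" using J_sub by (auto intro: SP.J)
  fix h x assume h: "h \<in> {Fu I2, Fu3, Ku I2, Kiu I2}" and x: "x \<in> SP" "Eu I2 * x \<in> SP"
  consider (f2) "h = Fu I2" | (f3) "h = Fu3" | (k) "h = Ku I2 \<or> h = Kiu I2"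
    using h by blast
  then show "Eu I2 * h * x \<in> SP"
  proof cases
    case f2
    have "Eu I2 * Fu I2 * x \<approx> (Fu I2 * Eu I2 + sc (1 / \<delta>) * (Ku I2 - Kiu I2)) * x"
      using U_EF[of I2 I2] by (auto intro!: ueq_mult ueq_refl)
    then show ?thesis unfolding f2
      by (rule SP_ueq) (simp add: distrib_right left_diff_distrib mult.assoc SP.intros SP_diff x)
  next
    case f3
    have "Eu I2 * Fu3 * x \<approx> (Fu3 * Eu I2 - sc q * (Fu I1 * Ku I2)) * x" by (intro ueq_mult ueq_refl U_E2F3)
    then show ?thesis unfolding f3
      by (rule SP_ueq) (simp add: left_diff_distrib mult.assoc SP.intros SP_diff SP_F1 x)
  next
    case k
    then have "\<exists>s. Eu I2 * h \<approx> sc s * (h * Eu I2)" by (elim disjE; hypsubst; intro scale_comm)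
    then obtain s where "Eu I2 * h \<approx> sc s * (h * Eu I2)" by blast
    then have "Eu I2 * h * x \<approx> sc s * (h * Eu I2) * x" by (rule ueq_right)
    then show ?thesis using k by (elim SP_ueq) (auto simp add: mult.assoc SP.K2 SP.K2i SP.sc x)
  qed
qed

lemma SP_UNIV: "x \<in> SP"
proof (induction x rule: fa_closure)
  case (gen g x)
  then show ?case
    by (cases g; rename_tac i; case_tac i) (auto intro: SP.intros SP_K1 SP_K1i SP_E1 SP_E2 SP_F1)
qed (auto intro: SP.intros)

section \<open>The monomials F_2^a F_3^b K_2^l and their linear combinations\<close>

definition Kp :: "int \<Rightarrow> fa" where "Kp l = (if l \<ge> 0 then Ku I2 ^ nat l else Kiu I2 ^ nat (- l))"

definition pbw :: "nat \<times> nat \<times> int \<Rightarrow> fa" where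
  "pbw = (\<lambda>(a, b, l). Fu I2 ^ a * Fu3 ^ b * Kp l)"

lemma K2_Kp: "Ku I2 * Kp l \<approx> Kp (l + 1)" and K2i_Kp: "Kiu I2 * Kp l \<approx> Kp (l - 1)"
proof -
  have n1: "nat (- l) = Suc (nat (- l - 1))" if "l < 0" using that by simp
  have n2: "nat l = Suc (nat (l - 1))" if "l > 0" using that by simp
  have n3: "nat (1 - l) = Suc (nat (- l))" if "l \<le> 0" using that by simp
  have "Ku I2 * Kp l = Kp (l + 1)" if "l \<ge> 0"
    using that by (simp add: Kp_def nat_add_distrib)
  moreover have "Ku I2 * Kp l \<approx> Kp (l + 1)" if "l < 0"
  proof -
    have "Ku I2 * Kp l = Ku I2 * Kiu I2 * Kiu I2 ^ nat (- l - 1)"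
      using that by (simp add: Kp_def mult.assoc n1)
    also have "\<dots> \<approx> 1 * Kiu I2 ^ nat (- l - 1)" by (intro ueq_mult ueq_refl U_KKi)
    also have "1 * Kiu I2 ^ nat (- l - 1) = Kp (l + 1)" using that by (auto simp: Kp_def)
    finally show ?thesis .
  qed
  ultimately show "Ku I2 * Kp l \<approx> Kp (l + 1)" by (cases "l \<ge> 0") (auto simp: ueq_refl)
  have "Kiu I2 * Kp l = Kp (l - 1)" if "l \<le> 0"
    using that by (auto simp: Kp_def n3)
  moreover have "Kiu I2 * Kp l \<approx> Kp (l - 1)" if "l > 0"
  proof -
    have "Kiu I2 * Kp l = Kiu I2 * Ku I2 * Ku I2 ^ nat (l - 1)"
      using that by (simp add: Kp_def mult.assoc n2)
    also have "\<dots> \<approx> 1 * Ku I2 ^ nat (l - 1)" by (intro ueq_mult ueq_refl U_KKi)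
    also have "1 * Ku I2 ^ nat (l - 1) = Kp (l - 1)" using that by (auto simp: Kp_def)
    finally show ?thesis .
  qed
  ultimately show "Kiu I2 * Kp l \<approx> Kp (l - 1)" by (cases "l \<le> 0") (auto simp: ueq_refl)
qed

lemma ueq_power_comm:
  assumes "x * y \<approx> sc s * (y * x)"
  shows "\<exists>t. x * y ^ n \<approx> sc t * (y ^ n * x)"
proof (induction n)
  case 0
  show ?case by (intro exI[of _ 1]) (simp add: sc_1 ueq_refl)
next
  case (Suc n)
  then obtain t where t: "x * y ^ n \<approx> sc t * (y ^ n * x)" by blast
  have "x * y ^ Suc n = (x * y ^ n) * y" by (simp add: power_Suc2 mult.assoc del: power_Suc)
  also have "\<dots> \<approx> sc t * (y ^ n * x) * y" by (intro ueq_mult ueq_refl t)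
  also have "\<dots> = sc t * (y ^ n * (x * y))" by (simp add: mult.assoc)
  also have "\<dots> \<approx> sc t * (y ^ n * (sc s * (y * x)))" by (intro ueq_mult ueq_refl assms)
  also have "\<dots> = sc (t * s) * (y ^ Suc n * x)"
    by (simp add: mult.assoc sc_central_left[of "_ ^ _"] sc_mult_left power_Suc2 del: power_Suc)
  finally show ?case by blast
qed

text \<open>\<open>SP\<close> is convenient for closure arguments, this set for reading off
  coefficients: its elements are explicit combinations of monomials modulo J. \<open>PB_SP\<close>
  passes from one to the other.\<close>

inductive_set PB :: "fa set" where
  J: "x \<in> J \<Longrightarrow> x \<in> PB"
| pbw: "sc k * pbw t \<in> PB"
| add: "x \<in> PB \<Longrightarrow> y \<in> PB \<Longrightarrow> x + y \<in> PB"

lemma PB_ueq: "x \<approx> y \<Longrightarrow> y \<in> PB \<Longrightarrow> x \<in> PB"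
  using PB.add[OF PB.J[OF Rel_J], of "x - y" y] by (simp add: ueq_def)

lemma PB_closed:
  assumes g: "\<And>t. \<exists>s t'. g * pbw t \<approx> sc s * pbw t'" and x: "x \<in> PB"
  shows "g * x \<in> PB"
  using x
proof induction
  case (pbw k t)
  obtain s t' where "g * pbw t \<approx> sc s * pbw t'" using g by blast
  then have "sc k * (g * pbw t) \<approx> sc k * (sc s * pbw t')" by (rule ueq_left)
  then have "g * (sc k * pbw t) \<approx> sc (k * s) * pbw t'" by (simp add: sc_central_left[of g] sc_mult_left)
  then show ?case by (rule PB_ueq) (rule PB.pbw)
next
  case (J x)
  then show ?case by (intro PB.J J_mult)
next
  case (add x y)
  then show ?case unfolding distrib_left by (intro PB.add)
qed

lemma K_pbw:
  assumes K: "\<And>l. \<exists>l'. g * Kp l \<approx> Kp l'"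
    and F2: "\<exists>s. g * Fu I2 \<approx> sc s * (Fu I2 * g)" and F3: "\<exists>s. g * Fu3 \<approx> sc s * (Fu3 * g)"
  shows "\<exists>s t'. g * pbw t \<approx> sc s * pbw t'"
proof -
  obtain a b l where abl: "t = (a, b, l)" by (cases t)
  obtain s where s: "g * Fu I2 ^ a \<approx> sc s * (Fu I2 ^ a * g)" using ueq_power_comm[of g "Fu I2"] F2 by metis
  obtain u where u: "g * Fu3 ^ b \<approx> sc u * (Fu3 ^ b * g)" using ueq_power_comm[of g "Fu3"] F3 by metis
  obtain l' where l': "g * Kp l \<approx> Kp l'" using K by blast
  have "g * pbw t = g * Fu I2 ^ a * (Fu3 ^ b * Kp l)" by (simp add: pbw_def mult.assoc abl)
  also have "\<dots> \<approx> sc s * (Fu I2 ^ a * g) * (Fu3 ^ b * Kp l)" by (intro ueq_right s)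
  also have "\<dots> = sc s * (Fu I2 ^ a * (g * Fu3 ^ b * Kp l))" by (simp add: mult.assoc)
  also have "\<dots> \<approx> sc s * (Fu I2 ^ a * (sc u * (Fu3 ^ b * g) * Kp l))" by (intro ueq_left ueq_right u)
  also have "\<dots> = sc (s * u) * (Fu I2 ^ a * (Fu3 ^ b * (g * Kp l)))"
    by (simp add: mult.assoc sc_central_left[of "Fu I2 ^ _"] sc_mult_left)
  also have "\<dots> \<approx> sc (s * u) * (Fu I2 ^ a * (Fu3 ^ b * Kp l'))" by (intro ueq_left l')
  also have "\<dots> = sc (s * u) * pbw (a, b, l')" by (simp add: pbw_def mult.assoc)
  finally show ?thesis by blast
qed

lemma PB_SP: "x \<in> SP \<Longrightarrow> x \<in> PB"
proof (induction rule: SP.induct)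
  case one
  show ?case using PB.pbw[of 1 "(0, 0, 0)"] by (simp add: pbw_def Kp_def sc_1)
next
  case (sc x k)
  show ?case
  proof (rule PB_closed[OF _ sc.IH])
    show "\<exists>s t'. sc k * pbw t \<approx> sc s * pbw t'" for t using ueq_refl by blast
  qed
next
  case (F2 x)
  show ?case
  proof (rule PB_closed[OF _ F2.IH])
    fix t :: "nat \<times> nat \<times> int"
    obtain a b l where t: "t = (a, b, l)" by (cases t)
    have "Fu I2 * pbw t = sc 1 * pbw (Suc a, b, l)" by (simp add: t pbw_def sc_1 mult.assoc)
    then show "\<exists>s t'. Fu I2 * pbw t \<approx> sc s * pbw t'" using ueq_refl by metis
  qed
next
  case (F3 x)
  show ?case
  proof (rule PB_closed[OF _ F3.IH])
    fix t :: "nat \<times> nat \<times> int"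
    obtain a b l where t: "t = (a, b, l)" by (cases t)
    obtain s where s: "Fu3 * Fu I2 ^ a \<approx> sc s * (Fu I2 ^ a * Fu3)" using ueq_power_comm[OF U_F3F2] by blast
    have "Fu3 * pbw t = Fu3 * Fu I2 ^ a * (Fu3 ^ b * Kp l)" by (simp add: t pbw_def mult.assoc)
    also have "\<dots> \<approx> sc s * (Fu I2 ^ a * Fu3) * (Fu3 ^ b * Kp l)" by (intro ueq_mult ueq_refl s)
    also have "\<dots> = sc s * pbw (a, Suc b, l)" by (simp add: pbw_def mult.assoc)
    finally show "\<exists>s t'. Fu3 * pbw t \<approx> sc s * pbw t'" by blast
  qed
next
  case (K2 x)
  show ?case by (rule PB_closed[OF K_pbw K2.IH]) (use K2_Kp scale_comm in blast)+
next
  case (K2i x)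
  show ?case by (rule PB_closed[OF K_pbw K2i.IH]) (use K2i_Kp scale_comm in blast)+
qed (auto intro: PB.intros)

lemma pbw_span:
  "\<exists>S k. finite S \<and> x - (\<Sum>t\<in>S. sc (k t) * pbw t) \<in> J"
proof -
  have "x \<in> PB" by (intro PB_SP SP_UNIV)
  \<comment> \<open>The coefficients are required to vanish off S so that two combinations can be
    added over the union of their index sets.\<close>
  then have "\<exists>S k. finite S \<and> (\<forall>t. t \<notin> S \<longrightarrow> k t = 0) \<and> x - (\<Sum>t\<in>S. sc (k t) * pbw t) \<in> J"
  proof induction
    case (J x)
    then show ?case by (intro exI[of _ "{}"] exI[of _ "\<lambda>_. 0"]) simp
  next
    case (pbw k t)
    show ?case by (intro exI[of _ "{t}"] exI[of _ "\<lambda>s. if s = t then k else 0"]) (simp add: J_0)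
  next
    case (add x y)
    then obtain S k T m where *: "finite S" "\<forall>t. t \<notin> S \<longrightarrow> k t = 0" "x - (\<Sum>t\<in>S. sc (k t) * pbw t) \<in> J"
      "finite T" "\<forall>t. t \<notin> T \<longrightarrow> m t = 0" "y - (\<Sum>t\<in>T. sc (m t) * pbw t) \<in> J" by blast
    have "(\<Sum>t\<in>S. sc (k t) * pbw t) = (\<Sum>t\<in>S \<union> T. sc (k t) * pbw t)"
      using * by (intro sum.mono_neutral_left) (auto simp: sc_0)
    moreover have "(\<Sum>t\<in>T. sc (m t) * pbw t) = (\<Sum>t\<in>S \<union> T. sc (m t) * pbw t)"
      using * by (intro sum.mono_neutral_left) (auto simp: sc_0)
    ultimately have "x + y - (\<Sum>t\<in>S \<union> T. sc (k t + m t) * pbw t) =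
       (x - (\<Sum>t\<in>S. sc (k t) * pbw t)) + (y - (\<Sum>t\<in>T. sc (m t) * pbw t))"
      by (simp add: sc_add distrib_right sum.distrib)
    also have "\<dots> \<in> J" using * J_add by blast
    finally show ?case using * by (intro exI[of _ "S \<union> T"] exI[of _ "\<lambda>t. k t + m t"]) auto
  qed
  then show ?thesis by blast
qed

end

section \<open>Faithfulness of the model\<close>

context whittaker begin

text \<open>K_1 F_2 = q F_2 K_1 makes the K_1 part of F_1 drop out of the q-commutator; the C_1 part
  contributes \<open>gone\<close> and the K_1^{-1} part the second summand.\<close>

lemma act_Fu3: "act Fu3 \<phi> l a b = Q l * (gone (\<phi> l) a b + q * \<delta> * xop (kiop (\<phi> (l - 2))) a b) / (\<alpha> * \<delta>^2)"
  using q0 \<alpha>0 q1 Q0[of l]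
  by (simp add: act_simps F3_def slice_lin slice_comm Qs Q4 ishift) (simp add: \<delta>_alt divide_simps; algebra)

lemma act_power: "act (x ^ Suc n) \<phi> = act x (act (x ^ n) \<phi>)" by (simp add: act_mult)

lemma act_Kp: "act (Kp n) \<phi> = (\<lambda>l. \<phi> (l - n))"
proof -
  have "act (Ku I2 ^ n) \<phi> = (\<lambda>l. \<phi> (l - int n))" "act (Kiu I2 ^ n) \<phi> = (\<lambda>l. \<phi> (l + int n))" for n
    by (induction n) (simp_all add: act_1 act_mult act_gelt algebra_simps)
  then show ?thesis by (simp add: Kp_def)
qed

lemma act_F2_power: "act (Fu I2 ^ n) \<phi> = (\<lambda>l a b. Q l ^ (2 * n) * \<phi> l (a - int n) b)"
  by (induction n) (simp_all add: act_1 act_mult act_gelt xop_def algebra_simps power_add power2_eq_square)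

text \<open>\<open>F_3\<close> raises \<open>b\<close> by one with a nonzero coefficient, modulo terms with the same \<open>b\<close>; the images of the
  PBW monomials in the model are therefore triangular with respect to \<open>b\<close>, hence independent.\<close>

lemma act_F3_Kp:
  "\<And>l a b. b > int n \<Longrightarrow> act (Fu3 ^ n * Kp m) vac l a b = 0"
  "\<exists>k. k \<noteq> 0 \<and> (\<forall>l a. act (Fu3 ^ n * Kp m) vac l a (int n) = (if l = m \<and> a = 0 then k else 0))"
proof -
  have "(\<forall>l a b. b > int n \<longrightarrow> act (Fu3 ^ n * Kp m) vac l a b = 0) \<and>
    (\<exists>k. k \<noteq> 0 \<and> (\<forall>l a. act (Fu3 ^ n * Kp m) vac l a (int n) = (if l = m \<and> a = 0 then k else 0)))"
  proof (induction n)
    case 0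
    show ?case by (auto simp: act_Kp vac_def intro!: exI[of _ 1])
  next
    case (Suc n)
    let ?\<phi> = "act (Fu3 ^ n * Kp m) vac"
    from Suc obtain k where z: "\<And>l a b. b > int n \<Longrightarrow> ?\<phi> l a b = 0" and k: "k \<noteq> 0"
      "\<And>l a. ?\<phi> l a (int n) = (if l = m \<and> a = 0 then k else 0)" by blast
    have s: "act (Fu3 ^ Suc n * Kp m) vac = act Fu3 ?\<phi>" by (simp add: act_mult)
    have "act Fu3 ?\<phi> l a b = 0" if "b > int (Suc n)" for l a b
      using that by (simp add: act_Fu3 gone_def xop_def kiop_def z)
    moreover have "act Fu3 ?\<phi> l a (int (Suc n)) = (if l = m \<and> a = 0 then Q m * k / (\<alpha> * \<delta>^2) else 0)" for l a
      by (auto simp add: act_Fu3 gone_def xop_def kiop_def z k Q_0)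
    moreover have "Q m * k / (\<alpha> * \<delta>^2) \<noteq> 0" using k \<alpha>0 d0 Q0 by simp
    ultimately show ?case unfolding s by blast
  qed
  then show "\<And>l a b. b > int n \<Longrightarrow> act (Fu3 ^ n * Kp m) vac l a b = 0"
    and "\<exists>k. k \<noteq> 0 \<and> (\<forall>l a. act (Fu3 ^ n * Kp m) vac l a (int n) = (if l = m \<and> a = 0 then k else 0))"
    by blast+
qed

lemma act_pbw:
  "b' > int b \<Longrightarrow> act (pbw (a, b, l)) vac l' a' b' = 0"
  "act (pbw (a, b, l)) vac l (int a) (int b) \<noteq> 0"
  "(l', a') \<noteq> (l, int a) \<Longrightarrow> act (pbw (a, b, l)) vac l' a' (int b) = 0"
proof -
  have e: "act (pbw (a, b, l)) vac l' a' b' = Q l' ^ (2 * a) * act (Fu3 ^ b * Kp l) vac l' (a' - int a) b'" for l' a' b'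
    by (simp add: pbw_def mult.assoc act_mult[of "Fu I2 ^ a"] act_F2_power)
  obtain k where "k \<noteq> 0" "\<forall>l' a. act (Fu3 ^ b * Kp l) vac l' a (int b) = (if l' = l \<and> a = 0 then k else 0)"
    using act_F3_Kp(2) by blast
  then show "act (pbw (a, b, l)) vac l (int a) (int b) \<noteq> 0"
    "(l', a') \<noteq> (l, int a) \<Longrightarrow> act (pbw (a, b, l)) vac l' a' (int b) = 0"
    by (auto simp: e Q0)
  show "b' > int b \<Longrightarrow> act (pbw (a, b, l)) vac l' a' b' = 0" by (simp add: e act_F3_Kp(1))
qed

lemma act_sum: "finite S \<Longrightarrow> act (\<Sum>t\<in>S. f t) \<phi> l a b = (\<Sum>t\<in>S. act (f t) \<phi> l a b)"
  by (induction S rule: finite_induct) (simp_all add: act_simps)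

text \<open>Faithfulness: modulo J the element x is a combination of monomials, and all its
  coefficients can be recovered from \<open>act x vac\<close>.\<close>

lemma act_vac_0_iff: "act x vac = (\<lambda>l a b. 0) \<longleftrightarrow> x \<in> J"
proof
  assume x: "act x vac = (\<lambda>l a b. 0)"
  obtain S k where S: "finite S" and xJ: "x - (\<Sum>t\<in>S. sc (k t) * pbw t) \<in> J" using pbw_span by blast
  have sum0: "(\<Sum>t\<in>S. k t * act (pbw t) vac l a b) = 0" for l a b
  proof -
    have "act (x - (\<Sum>t\<in>S. sc (k t) * pbw t)) vac l a b = 0" using act_Ann[OF xJ] by simp
    then show ?thesis using x S by (simp add: act_diff act_sum) (simp add: act_simps)
  qed
  have "k t = 0" if "t \<in> S" for t
  proof (rule ccontr)
    assume "k t \<noteq> 0"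
    let ?T = "{t \<in> S. k t \<noteq> 0}"
    have T: "finite ?T" "?T \<noteq> {}" using S that \<open>k t \<noteq> 0\<close> by (simp, blast)
    \<comment> \<open>N is the largest exponent of F_3 among the monomials with nonzero coefficient.
      For such a monomial with parameters a, N, l, no other one contributes at the coordinate (l, a,
      N).\<close>
    define N where "N = Max ((fst \<circ> snd) ` ?T)"
    have "N \<in> (fst \<circ> snd) ` ?T" unfolding N_def using T by (intro Max_in) auto
    then obtain a l where t: "(a, N, l) \<in> S" "k (a, N, l) \<noteq> 0" by auto
    have le: "b' \<le> N" if "(a', b', l') \<in> S" "k (a', b', l') \<noteq> 0" for a' b' l'
      unfolding N_def using T that by (intro Max_ge) force+
    have other: "k t' * act (pbw t') vac l (int a) (int N) = 0" if t': "t' \<in> S - {(a, N, l)}" for t'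
    proof (cases "k t' = 0")
      case False
      obtain a' b' l' where abl: "t' = (a', b', l')" by (cases t')
      have "b' \<le> N" using le t' False abl by blast
      then consider "b' < N" | "b' = N" "(l, int a) \<noteq> (l', int a')" using t' abl by fastforce
      then show ?thesis using act_pbw(1,3) by cases (auto simp: abl)
    qed simp
    have "(\<Sum>t\<in>S. k t * act (pbw t) vac l (int a) (int N)) = k (a, N, l) * act (pbw (a, N, l)) vac l (int a) (int N)"
      using sum.remove[OF S t(1)] sum.neutral[of "S - {(a, N, l)}"] other by (metis (no_types, lifting) add.right_neutral)
    then show False using sum0 act_pbw(2) t(2) by simp
  qed
  then have "(\<Sum>t\<in>S. sc (k t) * pbw t) = 0" by (simp add: sc_0)
  then show "x \<in> J" using xJ by simp
qed (rule act_Ann)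

section \<open>The filtration of the model by the index b\<close>

definition basis :: "int \<Rightarrow> int \<Rightarrow> int \<Rightarrow> vec" where
  "basis l a b = (\<lambda>l' a' b'. if l' = l \<and> a' = a \<and> b' = b then 1 else 0)"

definition supp :: "vec \<Rightarrow> (int \<times> int \<times> int) set" where "supp \<phi> = {(l, a, b). \<phi> l a b \<noteq> 0}"

definition above :: "int \<Rightarrow> vec set" where
  "above n = {\<phi>. finite (supp \<phi>) \<and> (\<forall>l a b. \<phi> l a b \<noteq> 0 \<longrightarrow> a \<ge> 0 \<and> b \<ge> n)}"

lemma vac_basis: "vac = basis 0 0 0" by (simp add: vac_def basis_def)

text \<open>A generator moves the level by at most 2 and a and b by at most 1, so the new support
  lies in finitely many translates of the old one.\<close>

lemma finite_supp_gact:
  assumes "finite (supp \<phi>)"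
  shows "finite (supp (gact g \<phi>))"
proof -
  let ?sh = "\<lambda>(i, j, k) (l, a, b). (l + i, a + j, b + k) :: int \<times> int \<times> int"
  have fin: "finite (\<Union>d\<in>{-2..2} \<times> {-1..1} \<times> {-1..1}. ?sh d ` supp \<phi>)" (is "finite ?U")
    using assms by (intro finite_UN_I) auto
  have *: "(l, a, b) \<in> ?U" if "\<phi> (l + i) (a + j) (b + k) \<noteq> 0" "i \<in> {-2..2}" "j \<in> {-1..1}" "k \<in> {-1..1}" for l a b i j k
  proof (intro UN_I[of "(-i, -j, -k)"] image_eqI[of _ _ "(l + i, a + j, b + k)"])
  qed (use that in \<open>auto simp: supp_def\<close>)
  have "(l, a, b) \<in> ?U" if "gact g \<phi> l a b \<noteq> 0" for l a b
  proof (rule ccontr)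
    assume n: "(l, a, b) \<notin> ?U"
    have z: "\<phi> (l + i) (a + j) (b + k) = 0" if "i \<in> {-2..2}" "j \<in> {-1..1}" "k \<in> {-1..1}" for i j k
      using *[OF _ that] n by blast
    have "gact g \<phi> l a b = 0"
      by (cases "(g, \<phi>)" rule: gact.cases)
        (use z[of 0 0 0] z[of 1 0 0] z[of "-1" 0 0] z[of 2 0 0] z[of "-2" 0 0] z[of 0 "-1" 0] z[of "-1" 0 1] z[of "-1" 1 0]
          z[of "1" 1 0] z[of 0 1 "-1"] z[of 0 "-1" 1] in \<open>simp_all add: slice_ops\<close>)
    then show False using that by simp
  qed
  then have "supp (gact g \<phi>) \<subseteq> ?U" by (auto simp only: supp_def)
  then show ?thesis using fin finite_subset by blast
qed

text \<open>A vector can leave the region only across a = 0 or b = n. The coefficient leading from a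
  = 0 to a = -1 contains [0] = 0, and the one leading from b = n to b = n - 1 contains
  \<open>lo n\<close>, which is 0 by assumption.\<close>

lemma gact_above:
  assumes n: "lo n = 0" and \<phi>: "\<phi> \<in> above n"
  shows "gact g \<phi> \<in> above n"
proof -
  have z: "\<phi> l a b = 0" if "a < 0 \<or> b < n" for l a b using \<phi> that unfolding above_def mem_Collect_eq by (metis linorder_not_le)
  have b0: "brk 0 = 0" by (simp add: brk_def Q_0)
  have l: "lo (b + 1) * \<phi> l a (b + 1) = 0" if "b < n" for l a b
    by (cases "b = n - 1") (use that n z in auto)
  have l': "x * lo (b + 1) * \<phi> l a (b + 1) = 0" if "b < n" for x l a b using l[OF that] by simp
  have br: "brk (a + 1) * \<phi> l (a + 1) b = 0" if "a < 0" for l a b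
    by (cases "a = - 1") (use that b0 z in auto)
  have br': "x * brk (a + 1) * \<phi> l (a + 1) b = 0" if "a < 0" for x l a b
    using br[OF that] by simp
  have br'': "x * brk (a + 1) / y * \<phi> l (a + 1) b = 0" "brk (a + 1) / y * \<phi> l (a + 1) b = 0"
     "- brk (a + 1) / y * \<phi> l (a + 1) b = 0"  if "a < 0" for x l a b y
    using br[OF that] by simp_all
  have "gact g \<phi> l a b = 0" if "a < 0 \<or> b < n" for l a b
    by (cases "(g, \<phi>)" rule: gact.cases; use that in \<open>elim disjE; simp add: slice_ops z l l' br br' br''\<close>)
  then show ?thesis using \<phi> finite_supp_gact unfolding above_def by force
qed

lemma above_0: "(\<lambda>l a b. 0) \<in> above n" by (simp add: above_def supp_def case_prod_unfold)
lemma above_add: assumes "\<phi> \<in> above n" "\<psi> \<in> above n" shows "(\<lambda>l a b. \<phi> l a b + \<psi> l a b) \<in> above n"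
proof -
  have "supp (\<lambda>l a b. \<phi> l a b + \<psi> l a b) \<subseteq> supp \<phi> \<union> supp \<psi>" by (auto simp: supp_def)
  then have "finite (supp (\<lambda>l a b. \<phi> l a b + \<psi> l a b))" using assms finite_subset by (fastforce simp: above_def)
  moreover have "a \<ge> 0 \<and> b \<ge> n" if "\<phi> l a b + \<psi> l a b \<noteq> 0" for l a b
  proof -
    have "\<phi> l a b \<noteq> 0 \<or> \<psi> l a b \<noteq> 0" using that by auto
    then show ?thesis using assms by (auto simp: above_def)
  qed
  ultimately show ?thesis by (auto simp: above_def)
qed
lemma above_scale: assumes "\<phi> \<in> above n" shows "(\<lambda>l a b. k * \<phi> l a b) \<in> above n"
proof -
  have "supp (\<lambda>l a b. k * \<phi> l a b) \<subseteq> supp \<phi>" by (auto simp: supp_def)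
  then show ?thesis using assms finite_subset by (fastforce simp: above_def)
qed

lemma act_above:
  assumes n: "lo n = 0" and \<phi>: "\<phi> \<in> above n"
  shows "act x \<phi> \<in> above n"
proof (induction x rule: fa_closure)
  case (gen g x)
  then show ?case using gact_above[OF n] by (simp add: act_simps del: gact.simps)
qed (use \<phi> in \<open>simp_all add: act_simps above_add above_scale\<close>)

end

section \<open>Submodules of the model\<close>

context whittaker begin

lemma Q_add: "Q (m + n) = Q m * Q n" using q0 by (simp add: Q_def power_int_add)

text \<open>The hypothesis that q is not a root of unity in the form used below: it separates the
  eigenvalues of E_1 and of K and makes [n] nonzero for n \<noteq> 0.\<close>

lemma Q_inj: "Q m = Q n \<longleftrightarrow> m = n"
proof -
  have *: False if "Q m = Q n" "m < n" for m n
  proof -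
    have "Q n = Q m * Q (n - m)" using Q_add[of m "n - m"] by simp
    moreover have "Q (n - m) = q ^ nat (n - m)" using that by (simp add: Q_def power_int_def)
    ultimately have "Q n = Q m * q ^ nat (n - m)" by simp
    then have "q ^ nat (n - m) = 1" using that Q0[of m] by simp
    then show False using qroot that by simp
  qed
  show ?thesis using *[of m n] *[of n m] by (cases m n rule: linorder_cases) auto
qed

lemma Q_eq_1: "Q n = 1 \<longleftrightarrow> n = 0" using Q_inj[of n 0] by (simp add: Q_0)

lemma brk_0: "brk n = 0 \<longleftrightarrow> n = 0"
proof -
  have "brk n = 0 \<longleftrightarrow> Q n * Q n = 1" using d0 Q0 by (simp add: brk_def field_simps)
  also have "\<dots> \<longleftrightarrow> Q (n + n) = 1" by (simp only: Q_add)
  finally show ?thesis by (simp add: Q_eq_1)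
qed

text \<open>The model counterpart of a submodule of V, once \<open>above 0\<close> is known to be
  the image of V. Scalars act through \<open>sc\<close>.\<close>

definition stable :: "vec set \<Rightarrow> bool" where
  "stable S \<longleftrightarrow> S \<subseteq> above 0 \<and> (\<lambda>l a b. 0) \<in> S
     \<and> (\<forall>\<phi>\<in>S. \<forall>\<psi>\<in>S. (\<lambda>l a b. \<phi> l a b + \<psi> l a b) \<in> S) \<and> (\<forall>x. \<forall>\<phi>\<in>S. act x \<phi> \<in> S)"

lemma lo_0: "lo 0 = 0" by (simp add: lo_def brk_0)

lemma stable_add: "stable S \<Longrightarrow> \<phi> \<in> S \<Longrightarrow> \<psi> \<in> S \<Longrightarrow> (\<lambda>l a b. \<phi> l a b + \<psi> l a b) \<in> S"
  and stable_act: "stable S \<Longrightarrow> \<phi> \<in> S \<Longrightarrow> act x \<phi> \<in> S"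
  by (auto simp: stable_def)
lemma stable_scale: "stable S \<Longrightarrow> \<phi> \<in> S \<Longrightarrow> (\<lambda>l a b. k * \<phi> l a b) \<in> S"
  using stable_act[of S \<phi> "sc k"] by (simp add: act_sc)
lemma stable_gact: "stable S \<Longrightarrow> \<phi> \<in> S \<Longrightarrow> gact g \<phi> \<in> S"
  using stable_act[of S \<phi> "gelt g"] by (simp add: act_gelt)

lemma stable_supp:
  assumes "stable S" "\<phi> \<in> S"
  shows "finite (supp \<phi>)" "\<phi> l a b \<noteq> 0 \<Longrightarrow> a \<ge> 0 \<and> b \<ge> 0"
  using assms by (auto simp: stable_def above_def)

lemma above_stable: "lo n = 0 \<Longrightarrow> n \<ge> 0 \<Longrightarrow> stable (above n)"
  unfolding stable_def by (auto simp: above_0 above_add act_above) (force simp: above_def)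

text \<open>Projection to an eigenspace by Lagrange interpolation: finite support leaves finitely
  many eigenvalues other than \<mu>, and each is removed by one linear factor. M lists those still
  to be removed.\<close>

lemma stable_restrict:
  assumes S: "stable S" and \<phi>: "\<phi> \<in> S"
    and T: "\<And>\<psi>. \<psi> \<in> S \<Longrightarrow> (\<lambda>l a b. \<theta> l a b * \<psi> l a b) \<in> S"
  shows "(\<lambda>l a b. if \<theta> l a b = \<mu> then \<phi> l a b else 0) \<in> S"
proof -
  have "(\<lambda>l a b. if \<theta> l a b = \<mu> then \<phi> l a b else 0) \<in> S"
    if "finite M" "\<mu> \<notin> M" "\<phi> \<in> S" "\<And>l a b. \<phi> l a b \<noteq> 0 \<Longrightarrow> \<theta> l a b \<in> insert \<mu> M" for M \<phi>
    using that
  proof (induction M arbitrary: \<phi> rule: finite_induct)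
    case empty
    then have "(\<lambda>l a b. if \<theta> l a b = \<mu> then \<phi> l a b else 0) = \<phi>" by (auto simp: fun_eq_iff)
    then show ?case using empty by simp
  next
    case (insert \<nu> M)
    \<comment> \<open>The factor (\<theta> - \<nu>) / (\<mu> - \<nu>) kills the part with eigenvalue
      \<nu> and is 1 on the part with eigenvalue \<mu>.\<close>
    let ?\<psi> = "\<lambda>l a b. 1 / (\<mu> - \<nu>) * (\<theta> l a b * \<phi> l a b + - \<nu> * \<phi> l a b)"
    have ne: "\<mu> \<noteq> \<nu>" using insert.prems by auto
    have "?\<psi> \<in> S" by (intro stable_scale[OF S] stable_add[OF S] T insert.prems)
    moreover have "\<theta> l a b \<in> insert \<mu> M" if "?\<psi> l a b \<noteq> 0" for l a b
    proof -
      have "\<phi> l a b \<noteq> 0" "\<theta> l a b \<noteq> \<nu>" using that by auto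
      then show ?thesis using insert.prems(3)[of l a b] by auto
    qed
    ultimately have "(\<lambda>l a b. if \<theta> l a b = \<mu> then ?\<psi> l a b else 0) \<in> S"
      using insert.prems(1) by (intro insert.IH) auto
    moreover have "(\<lambda>l a b. if \<theta> l a b = \<mu> then ?\<psi> l a b else 0) = (\<lambda>l a b. if \<theta> l a b = \<mu> then \<phi> l a b else 0)"
    proof (intro ext)
      fix l a b
      have "?\<psi> l a b = \<phi> l a b" if "\<theta> l a b = \<mu>"
      proof -
        have "?\<psi> l a b = 1 / (\<mu> - \<nu>) * ((\<mu> - \<nu>) * \<phi> l a b)" unfolding that by (simp add: left_diff_distrib)
        then show ?thesis using ne by simp
      qed
      then show "(if \<theta> l a b = \<mu> then ?\<psi> l a b else 0) = (if \<theta> l a b = \<mu> then \<phi> l a b else 0)" by auto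
    qed
    ultimately show ?case by simp
  qed
  moreover have "finite ((\<lambda>(l, a, b). \<theta> l a b) ` supp \<phi> - {\<mu>})" using stable_supp(1)[OF S \<phi>] by blast
  moreover have "\<theta> l a b \<in> insert \<mu> ((\<lambda>(l, a, b). \<theta> l a b) ` supp \<phi> - {\<mu>})" if "\<phi> l a b \<noteq> 0" for l a b
  proof -
    have "(l, a, b) \<in> supp \<phi>" using that by (simp add: supp_def)
    then have "(\<lambda>(l, a, b). \<theta> l a b) (l, a, b) \<in> (\<lambda>(l, a, b). \<theta> l a b) ` supp \<phi>" by (rule imageI)
    then show ?thesis by simp
  qed
  ultimately show ?thesis using \<phi> by (elim meta_allE[of _ "(\<lambda>(l, a, b). \<theta> l a b) ` supp \<phi> - {\<mu>}"] meta_allE[of _ \<phi>]) simp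
qed

lemma stable_level:
  assumes S: "stable S" and \<phi>: "\<phi> \<in> S"
  shows "(\<lambda>l a b. if l = m then \<phi> l a b else 0) \<in> S"
proof -
  have "(\<lambda>l a b. if \<alpha> * Q l = \<alpha> * Q m then \<phi> l a b else 0) \<in> S"
  proof (rule stable_restrict[OF S \<phi>])
    fix \<psi> assume "\<psi> \<in> S"
    then show "(\<lambda>l a b. \<alpha> * Q l * \<psi> l a b) \<in> S" using stable_gact[OF S, of \<psi> "gE I1"] by simp
  qed
  then show ?thesis using \<alpha>0 by (simp add: Q_inj)
qed

text \<open>The eigenvalue of K on F_2^a g_b depends on a + b only and determines it.\<close>

lemma stable_degree:
  assumes S: "stable S" and \<phi>: "\<phi> \<in> S"
  shows "(\<lambda>l a b. if a + b = n then \<phi> l a b else 0) \<in> S"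
proof -
  have "(\<lambda>l a b. if \<kappa> / Q (a + b) ^ 3 = \<kappa> / Q n ^ 3 then \<phi> l a b else 0) \<in> S"
  proof (rule stable_restrict[OF S \<phi>])
    fix \<psi> assume "\<psi> \<in> S"
    then have "act Kel \<psi> \<in> S" by (rule stable_act[OF S])
    moreover have "act Kel \<psi> = (\<lambda>l a b. \<kappa> / (Q a * Q b) ^ 3 * \<psi> l a b)"
      by (simp add: Kel_def act_simps power2_eq_square kop_def fun_eq_iff)
    ultimately show "(\<lambda>l a b. \<kappa> / Q (a + b) ^ 3 * \<psi> l a b) \<in> S" by (simp only: Q_add)
  qed
  moreover have "\<kappa> / Q k ^ 3 = \<kappa> / Q n ^ 3 \<longleftrightarrow> k = n" for k
  proof -
    have Q3: "Q m ^ 3 = Q (m + m + m)" for m by (simp only: Q_add power3_eq_cube)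
    have "\<kappa> / Q k ^ 3 = \<kappa> / Q n ^ 3 \<longleftrightarrow> Q k ^ 3 = Q n ^ 3" using \<kappa>0 by simp
    also have "\<dots> \<longleftrightarrow> k = n" unfolding Q3 Q_inj by simp
    finally show ?thesis .
  qed
  ultimately show ?thesis by simp
qed

lemma gact_K_basis: "act (Kp n) (basis l a b) = basis (l + n) a b"
  by (auto simp: act_Kp basis_def fun_eq_iff)

lemma stable_basis:
  assumes S: "stable S" and m: "basis 0 0 b \<in> S" and a: "a \<ge> 0"
  shows "basis l a b \<in> S"
proof -
  have "act (Fu I2 ^ nat a) (basis 0 0 b) = basis 0 a b"
    using a by (auto simp: act_F2_power basis_def fun_eq_iff Q_0)
  then have "basis 0 a b \<in> S" using stable_act[OF S m, of "Fu I2 ^ nat a"] by simp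
  then have "act (Kp l) (basis 0 a b) \<in> S" by (rule stable_act[OF S])
  then show ?thesis by (simp add: gact_K_basis)
qed

text \<open>E_2 sends level 0 to level 1 by A_+ and to level -1 by A_-. Projecting to level -1 and
  shifting back by K_2 isolates A_-; nothing else reaches level -1, because \<phi> has no part in
  level -2.\<close>

lemma stable_lower:
  assumes S: "stable S" and \<phi>: "\<phi> \<in> S" "\<And>l a b. \<phi> l a b \<noteq> 0 \<Longrightarrow> l = 0"
  shows "(\<lambda>l a b. if l = 0 then aminus (\<phi> 0) a b else 0) \<in> S"
proof -
  have "act (Kp 1) (\<lambda>l a b. if l = -1 then gact (gE I2) \<phi> l a b else 0) \<in> S"
    by (intro stable_act[OF S] stable_level[OF S] stable_gact[OF S] \<phi>)
  moreover have "act (Kp 1) (\<lambda>l a b. if l = -1 then gact (gE I2) \<phi> l a b else 0) = (\<lambda>l a b. if l = 0 then aminus (\<phi> 0) a b else 0)"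
  proof -
    have "\<phi> (- 2) = (\<lambda>a b. 0)" using \<phi>(2)[of "-2"] by (auto simp: fun_eq_iff)
    then show ?thesis by (auto simp: act_Kp fun_eq_iff Q_0 aplus_def)
  qed
  ultimately show ?thesis by simp
qed

text \<open>In level 0 and degree n a vector is a sum of terms x_a F_2^a g_{n-a}. Each g_{n-a} that
  occurs is obtained by induction on a bound N for a, with n free because A_- lowers the
  degree.\<close>

lemma stable_extract:
  assumes S: "stable S"
  shows "\<phi> \<in> S \<Longrightarrow> (\<And>l a b. \<phi> l a b \<noteq> 0 \<Longrightarrow> l = 0 \<and> a + b = n \<and> a \<le> int N) \<Longrightarrow> \<phi> 0 a b \<noteq> 0 \<Longrightarrow> basis 0 0 b \<in> S"
proof (induction N arbitrary: \<phi> n a b)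
  case 0
  have "a = 0" "b = n" using 0(2)[OF 0(3)] stable_supp(2)[OF S 0(1) 0(3)] by auto
  have h: "\<phi> l a' b' = \<phi> 0 a b * basis 0 0 b l a' b'" for l a' b'
  proof -
    show "\<phi> l a' b' = \<phi> 0 a b * basis 0 0 b l a' b'"
    proof (cases "\<phi> l a' b' = 0")
      case True
      then show ?thesis using 0(3) \<open>a = 0\<close> by (auto simp: basis_def)
    next
      case False
      have "l = 0" "a' = 0" "b' = n" using 0(2)[OF False] stable_supp(2)[OF S 0(1) False] by auto
      then show ?thesis using \<open>a = 0\<close> \<open>b = n\<close> by (simp add: basis_def)
    qed
  qed
  have "basis 0 0 b l a' b' = 1 / \<phi> 0 a b * \<phi> l a' b'" for l a' b'
    by (subst h) (use 0(3) in simp)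
  then have "basis 0 0 b = (\<lambda>l a' b'. 1 / \<phi> 0 a b * \<phi> l a' b')" by (intro ext)
  then show ?case using stable_scale[OF S 0(1)] by metis
next
  case (Suc N)
  let ?b = "n - int (Suc N)"
  let ?x = "\<phi> 0 (int (Suc N)) ?b"
  show ?case
  proof (cases "?x = 0")
    case True
    have "l = 0 \<and> a + b = n \<and> a \<le> int N" if "\<phi> l a b \<noteq> 0" for l a b
    proof -
      have *: "l = 0 \<and> a + b = n \<and> a \<le> int (Suc N)" using Suc.prems(2)[OF that] .
      moreover have "a \<noteq> int (Suc N)" using True * that by auto
      ultimately show ?thesis by auto
    qed
    then show ?thesis by (rule Suc.IH[OF Suc.prems(1) _ Suc.prems(3)])
  next
    case False
    \<comment> \<open>Applying A_- lowers the bound and keeps the top coefficient nonzero, since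
      [N + 1] \<noteq> 0; the induction hypothesis thus yields g_b for the top term.\<close>
    let ?\<psi> = "\<lambda>l a b. if l = 0 then aminus (\<phi> 0) a b else 0"
    have "?\<psi> \<in> S" using Suc.prems by (intro stable_lower[OF S]) blast+
    moreover have "l = 0 \<and> a + b = n - 1 \<and> a \<le> int N" if "?\<psi> l a b \<noteq> 0" for l a b
    proof -
      have "l = 0" "\<phi> 0 (a + 1) b \<noteq> 0" using that by (auto simp: aminus_def split: if_splits)
      then show ?thesis using Suc.prems(2)[of 0 "a + 1" b] by auto
    qed
    moreover have "?\<psi> 0 (int N) ?b \<noteq> 0"
      using False d0 Q0 by (simp add: aminus_def brk_0 add.commute)
    ultimately have m: "basis 0 0 ?b \<in> S" by (rule Suc.IH)
    show ?thesis
    proof (cases "b = ?b")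
      case True
      then show ?thesis using m by simp
    next
      case ne: False
      \<comment> \<open>With that g_b available, the whole top term lies in S and can be subtracted,
        which lowers the bound without changing the other coefficients.\<close>
      let ?\<chi> = "\<lambda>l a' b'. \<phi> l a' b' + - ?x * basis 0 (int (Suc N)) ?b l a' b'"
      have "?\<chi> \<in> S" by (intro stable_add[OF S] stable_scale[OF S] Suc.prems stable_basis[OF S m]) simp
      moreover have "l = 0 \<and> a + b = n \<and> a \<le> int N" if "?\<chi> l a b \<noteq> 0" for l a b
      proof -
        have "\<phi> l a b \<noteq> 0" using that by (auto simp: basis_def split: if_splits)
        then have *: "l = 0 \<and> a + b = n \<and> a \<le> int (Suc N)" using Suc.prems(2) by blast
        moreover have "a \<noteq> int (Suc N)" using * that by (auto simp: basis_def)
        ultimately show ?thesis by auto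
      qed
      moreover have "?\<chi> 0 a b \<noteq> 0" using Suc.prems(3) ne by (simp add: basis_def)
      ultimately show ?thesis by (rule Suc.IH)
    qed
  qed
qed

lemma stable_component:
  assumes S: "stable S" and \<phi>: "\<phi> \<in> S" "\<phi> l a b \<noteq> 0"
  shows "basis 0 0 b \<in> S"
proof -
  let ?\<psi> = "\<lambda>l' a' b'. if a' + b' = a + b then if l' = l then \<phi> l' a' b' else 0 else 0"
  have "?\<psi> \<in> S" by (intro stable_degree[OF S] stable_level[OF S] \<phi>)
  then have *: "act (Kp (- l)) ?\<psi> \<in> S" by (rule stable_act[OF S])
  have ab: "a \<ge> 0 \<and> b \<ge> 0" by (rule stable_supp(2)[OF S \<phi>])
  have "l' = 0 \<and> a' + b' = a + b \<and> a' \<le> int (nat (a + b))" if "act (Kp (- l)) ?\<psi> l' a' b' \<noteq> 0" for l' a' b'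
    using that stable_supp(2)[OF S \<phi>(1), of l a' b'] ab by (auto simp: act_Kp split: if_splits)
  moreover have "act (Kp (- l)) ?\<psi> 0 a b \<noteq> 0" using \<phi>(2) by (simp add: act_Kp)
  ultimately show ?thesis using stable_extract[OF S *] by blast
qed

lemma stable_up: assumes S: "stable S" and m: "basis 0 0 b \<in> S" shows "basis 0 0 (b + 1) \<in> S"
proof (rule stable_component[OF S])
  show "act Fu3 (basis 0 0 b) \<in> S" using S m by (rule stable_act)
  show "act Fu3 (basis 0 0 b) 0 0 (b + 1) \<noteq> 0"
    using \<alpha>0 d0 by (simp add: act_Fu3 basis_def gone_def xop_def kiop_def Q_0)
qed

text \<open>A_- annihilates g_b, so E_2 g_b = \<open>lo b\<close> K_2 g_{b-1}.\<close>

lemma stable_down: assumes S: "stable S" and m: "basis 0 0 b \<in> S" and lo: "lo b \<noteq> 0" shows "basis 0 0 (b - 1) \<in> S"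
proof (rule stable_component[OF S])
  show "gact (gE I2) (basis 0 0 b) \<in> S" using S m by (rule stable_gact)
  show "gact (gE I2) (basis 0 0 b) 1 0 (b - 1) \<noteq> 0"
    using lo by (simp add: basis_def aplus_def aminus_def Q_0)
qed

lemma above_sum:
  assumes S: "stable S" and \<phi>: "finite (supp \<phi>)" "\<And>l a b. \<phi> l a b \<noteq> 0 \<Longrightarrow> a \<ge> 0 \<and> basis 0 0 b \<in> S"
  shows "\<phi> \<in> S"
proof -
  have "\<phi> \<in> S" if "finite M" "supp \<phi> = M" "\<And>l a b. \<phi> l a b \<noteq> 0 \<Longrightarrow> a \<ge> 0 \<and> basis 0 0 b \<in> S" for M \<phi>
    using that
  proof (induction M arbitrary: \<phi> rule: finite_induct)
    case empty
    then have "\<phi> = (\<lambda>l a b. 0)" by (auto simp: supp_def fun_eq_iff)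
    then show ?case using S by (simp add: stable_def)
  next
    case (insert t M)
    obtain l a b where t: "t = (l, a, b)" by (cases t)
    let ?\<psi> = "\<lambda>l' a' b'. if (l', a', b') = t then 0 else \<phi> l' a' b'"
    have "supp ?\<psi> = M" using insert.prems(1) insert.hyps(2) by (auto simp: supp_def)
    then have "?\<psi> \<in> S" using insert.prems(2) by (intro insert.IH) (auto split: if_splits)
    moreover have "(l, a, b) \<in> supp \<phi>" using insert.prems(1) t by simp
    then have "\<phi> l a b \<noteq> 0" by (simp add: supp_def)
    then have "basis l a b \<in> S" using insert.prems(2) stable_basis[OF S] by blast
    ultimately have "(\<lambda>l' a' b'. ?\<psi> l' a' b' + \<phi> l a b * basis l a b l' a' b') \<in> S"
      by (intro stable_add[OF S] stable_scale[OF S])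
    moreover have "(\<lambda>l' a' b'. ?\<psi> l' a' b' + \<phi> l a b * basis l a b l' a' b') = \<phi>"
      by (auto simp: fun_eq_iff basis_def t)
    ultimately show ?case by simp
  qed
  then show ?thesis using \<phi> by blast
qed

lemma stable_above:
  assumes S: "stable S" and ne: "\<phi> \<in> S" "\<phi> l a b \<noteq> 0"
  shows "\<exists>n::nat. lo (int n) = 0 \<and> S = above (int n)"
proof -
  let ?P = "\<lambda>n. basis 0 0 (int n) \<in> S"
  have "b \<ge> 0" using stable_supp(2)[OF S ne] by simp
  then have P: "?P (nat b)" using stable_component[OF S ne] by simp
  define n where "n = (LEAST n. ?P n)"
  have n: "?P n" unfolding n_def using P by (rule LeastI)
  have least: "n \<le> m" if "?P m" for m unfolding n_def using that by (rule Least_le)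
  have up: "?P (n + k)" for k
  proof (induction k)
    case (Suc k)
    from stable_up[OF S this] show ?case by (simp add: add.commute add.left_commute)
  qed (use n in simp)
  have "lo (int n) = 0"
  proof (rule ccontr)
    assume lo: "lo (int n) \<noteq> 0"
    then have "n \<noteq> 0" using lo_0 by (intro notI) simp
    then have "?P (n - 1)" using stable_down[OF S n lo] by (simp add: of_nat_diff)
    then show False using least \<open>n \<noteq> 0\<close> by fastforce
  qed
  moreover have "S = above (int n)"
  proof
    show "S \<subseteq> above (int n)"
    proof
      fix \<psi> assume \<psi>: "\<psi> \<in> S"
      have "b \<ge> int n" if "\<psi> l a b \<noteq> 0" for l a b
      proof -
        have "b \<ge> 0" using stable_supp(2)[OF S \<psi> that] by simp
        then have "?P (nat b)" using stable_component[OF S \<psi> that] by simp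
        then show ?thesis using least[of "nat b"] \<open>b \<ge> 0\<close> by linarith
      qed
      then show "\<psi> \<in> above (int n)" using stable_supp[OF S \<psi>] by (auto simp: above_def)
    qed
    show "above (int n) \<subseteq> S"
    proof
      fix \<psi> assume \<psi>: "\<psi> \<in> above (int n)"
      have "basis 0 0 b \<in> S" if "b \<ge> int n" for b
        using up[of "nat (b - int n)"] that by simp
      then show "\<psi> \<in> S" using \<psi> by (intro above_sum[OF S]) (auto simp: above_def)
    qed
  qed
  ultimately show ?thesis by blast
qed

lemma basis_above: "a \<ge> 0 \<Longrightarrow> basis l a n \<in> above n"
proof -
  have "supp (basis l a n) = {(l, a, n)}" by (auto simp: supp_def basis_def)
  then show "a \<ge> 0 \<Longrightarrow> basis l a n \<in> above n" by (auto simp: above_def basis_def split: if_splits)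
qed

text \<open>That g_n generates \<open>above n\<close> needs no computation: the orbit is stable, so
  by \<open>stable_above\<close> it is some \<open>above k\<close>, and comparing which g_b lie on
  each side gives k = n.\<close>

lemma orbit_above:
  assumes n: "lo (int n) = 0"
  shows "range (\<lambda>x. act x (basis 0 0 (int n))) = above (int n)"
proof -
  let ?R = "range (\<lambda>x. act x (basis 0 0 (int n)))"
  have sub: "?R \<subseteq> above (int n)" using act_above[OF n basis_above] by auto
  have S: "stable ?R" unfolding stable_def
  proof (intro conjI ballI allI)
    show "?R \<subseteq> above 0" using sub by (force simp: above_def)
    show "(\<lambda>l a b. 0) \<in> ?R" using act_0 by (metis rangeI)
    fix \<phi> \<psi> assume "\<phi> \<in> ?R" "\<psi> \<in> ?R"
    then show "(\<lambda>l a b. \<phi> l a b + \<psi> l a b) \<in> ?R" by (auto simp flip: act_add_left)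
  next
    fix x \<phi> assume "\<phi> \<in> ?R"
    then show "act x \<phi> \<in> ?R" by (auto simp flip: act_mult)
  qed
  have m: "basis 0 0 (int n) \<in> ?R" using act_1 by (metis rangeI)
  then obtain k where k: "?R = above (int k)" using stable_above[OF S m, of 0 0 "int n"] by (auto simp: basis_def)
  have *: "j \<le> b" if "basis 0 0 b \<in> above j" for j b
  proof -
    have "basis 0 0 b 0 0 b \<noteq> 0" by (simp add: basis_def)
    then show ?thesis using that unfolding above_def by blast
  qed
  have "int k \<le> int n" using m unfolding k by (rule *)
  moreover have "basis 0 0 (int k) \<in> above (int n)" using sub basis_above[of 0 0 "int k"] unfolding k by auto
  then have "int n \<le> int k" by (rule *)
  ultimately show ?thesis using k by simp
qed

end

section \<open>The vectors \<open>u(n,0,1)\<close>\<close>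

context whittaker begin

text \<open>This element commutes with \<open>E_1\<close> and raises \<open>g_b\<close> to \<open>g_{b+1}\<close>.\<close>

definition Gel :: fa where
  "Gel = sc (\<delta>^2) * Fu3 * Eu I1 - sc (\<delta> / q) * Fu I2 * Kiu I1 + sc (q * \<delta>) * Fu I2 * Kel"

lemma Kel_act: "act Kel \<phi> = (\<lambda>l a b. \<kappa> / (Q a * Q b) ^ 3 * \<phi> l a b)"
  by (simp add: Kel_def act_simps power2_eq_square kop_def fun_eq_iff)

lemma act_Gel: "act Gel \<phi> = (\<lambda>l a b. \<delta>^2 * act Fu3 (e1 \<phi>) l a b - \<delta> / q * f2 (k1i \<phi>) l a b + q * \<delta> * f2 (act Kel \<phi>) l a b)"
  by (simp add: Gel_def act_simps del: gact.simps)

text \<open>Up to the factor \<delta>^2, F_3 E_1 already produces g_{n+1}. The term with F_2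
  K_1^{-1} in \<open>Gel\<close> removes what F_3 puts into level 2, the term with F_2 K removes its
  multiple of F_2 g_n.\<close>

lemma Gel_basis: "act Gel (basis 0 0 n) = basis 0 0 (n + 1)"
proof (intro ext)
  fix l a b
  show "act Gel (basis 0 0 n) l a b = basis 0 0 (n + 1) l a b"
    using q0 \<alpha>0 \<kappa>0 d0 Q0[of n]
    by (auto simp: act_Gel act_Fu3 Kel_act basis_def gone_def xop_def kiop_def Q_0 power2_eq_square power3_eq_cube field_simps)
qed

lemma act_ueq: "x \<approx> y \<Longrightarrow> act x \<phi> = act y \<phi>"
  using act_Rel[of "x - y" \<phi>] by (auto simp: ueq_def act_diff fun_eq_iff)

lemma fa_ops:
  "e1 (act Fu3 \<phi>) = (\<lambda>l a b. act Fu3 (e1 \<phi>) l a b + f2 (k1i \<phi>) l a b)"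
  "k1i (act Fu3 \<phi>) = (\<lambda>l a b. q * act Fu3 (k1i \<phi>) l a b)"
  "k1i (f2 \<phi>) = (\<lambda>l a b. f2 (k1i \<phi>) l a b / q)"
  "act Fu3 (f2 \<phi>) = (\<lambda>l a b. f2 (act Fu3 \<phi>) l a b / q)"
  "act Kel (act Fu3 \<phi>) = (\<lambda>l a b. act Fu3 (act Kel \<phi>) l a b / q^3)"
  "act Kel (f2 \<phi>) = (\<lambda>l a b. f2 (act Kel \<phi>) l a b / q^3)"
proof -
  show "e1 (act Fu3 \<phi>) = (\<lambda>l a b. act Fu3 (e1 \<phi>) l a b + f2 (k1i \<phi>) l a b)"
    using act_ueq[OF U_E1F3] by (simp add: act_simps del: gact.simps)
  show "k1i (act Fu3 \<phi>) = (\<lambda>l a b. q * act Fu3 (k1i \<phi>) l a b)"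
    using act_ueq[OF U_KF3(2), of I1] q0 by (simp add: act_simps del: gact.simps)
  show "k1i (f2 \<phi>) = (\<lambda>l a b. f2 (k1i \<phi>) l a b / q)"
    using act_ueq[OF U_KF(2), of I1 I2] q0 by (simp add: act_simps del: gact.simps)
  show "act Fu3 (f2 \<phi>) = (\<lambda>l a b. f2 (act Fu3 \<phi>) l a b / q)"
    using act_ueq[OF U_F3F2] by (simp add: act_simps del: gact.simps)
  show "act Kel (act Fu3 \<phi>) = (\<lambda>l a b. act Fu3 (act Kel \<phi>) l a b / q^3)"
    using q0 \<kappa>0 d0 \<alpha>0 by (auto simp: Kel_act act_Fu3 gone_def xop_def kiop_def fun_eq_iff Qs Q0 divide_simps) (auto simp: algebra_simps)
  show "act Kel (f2 \<phi>) = (\<lambda>l a b. f2 (act Kel \<phi>) l a b / q^3)"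
    using q0 by (auto simp: Kel_act xop_def fun_eq_iff Qs Q0 divide_simps)
qed

lemma f2_linear: "f2 (\<lambda>l a b. \<phi> l a b + \<psi> l a b) = (\<lambda>l a b. f2 \<phi> l a b + f2 \<psi> l a b)"
  "f2 (\<lambda>l a b. k * \<phi> l a b) = (\<lambda>l a b. k * f2 \<phi> l a b)"
  by (rule gact_linear)+

text \<open>The image in the model of F_2^p F_3^k K_2^i applied to the generator. The vectors in
  u(n,0,1) have p = n - k and an even i = 2j.\<close>

definition fv :: "nat \<Rightarrow> nat \<Rightarrow> nat \<Rightarrow> vec" where
  "fv p k i = (f2 ^^ p) ((act Fu3 ^^ k) (basis (int i) 0 0))"

lemma fv_Suc: "f2 (fv p k i) = fv (Suc p) k i" "act Fu3 (fv 0 k i) = fv 0 (Suc k) i"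
  by (simp_all add: fv_def del: gact.simps)

lemma F3_fv: "act Fu3 (fv p k i) = (\<lambda>l a b. 1 / q ^ p * fv p (Suc k) i l a b)"
proof (induction p)
  case (Suc p)
  have "act Fu3 (fv (Suc p) k i) = (\<lambda>l a b. 1 / q * f2 (act Fu3 (fv p k i)) l a b)"
    by (simp add: fa_ops flip: fv_Suc(1) del: gact.simps)
  then show ?case unfolding Suc f2_linear fv_Suc by (simp add: mult.commute)
qed (simp add: fv_Suc)

lemma k1i_fv: "k1i (fv p k i) = (\<lambda>l a b. q ^ k / (q ^ p * \<kappa>) * fv p k (i + 2) l a b)"
proof (induction p)
  case 0
  show ?case
  proof (induction k)
    case 0
    show ?case by (auto simp: fv_def basis_def fun_eq_iff kiop_def Q_0)
  next
    case (Suc k)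
    have "k1i (fv 0 (Suc k) i) = (\<lambda>l a b. q * act Fu3 (k1i (fv 0 k i)) l a b)"
      by (simp add: fa_ops flip: fv_Suc(2) del: gact.simps)
    then show ?case unfolding Suc act_linear fv_Suc by (simp add: mult.assoc)
  qed
next
  case (Suc p)
  have "k1i (fv (Suc p) k i) = (\<lambda>l a b. f2 (k1i (fv p k i)) l a b / q)"
    by (simp add: fa_ops flip: fv_Suc(1) del: gact.simps)
  then show ?case unfolding Suc f2_linear fv_Suc by (simp add: mult.commute mult.left_commute)
qed

lemma Kel_fv: "act Kel (fv p k i) = (\<lambda>l a b. \<kappa> / q ^ (3 * (p + k)) * fv p k i l a b)"
proof (induction p)
  case 0
  show ?case
  proof (induction k)
    case 0
    show ?case by (auto simp: fv_def basis_def fun_eq_iff Kel_act Q_0)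
  next
    case (Suc k)
    have "act Kel (fv 0 (Suc k) i) = (\<lambda>l a b. 1 / q^3 * act Fu3 (act Kel (fv 0 k i)) l a b)"
      by (simp add: fa_ops flip: fv_Suc(2) del: gact.simps)
    then show ?case unfolding Suc act_linear fv_Suc by (simp add: power_add mult.commute mult.left_commute)
  qed
next
  case (Suc p)
  have "act Kel (fv (Suc p) k i) = (\<lambda>l a b. 1 / q^3 * f2 (act Kel (fv p k i)) l a b)"
    by (simp add: fa_ops flip: fv_Suc(1) del: gact.simps)
  then show ?case unfolding Suc f2_linear fv_Suc by (simp add: power_add mult.commute mult.left_commute)
qed

lemma Q_nat: "Q (int n) = q ^ n" by (simp add: Q_def)

lemma brk_zero: "brk 0 = 0" by (simp add: brk_0)

lemma brk_Suc: "brk (int (Suc k)) = brk (int k) / q + q ^ k"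
  using q0 d0 q1 by (simp add: brk_def Q_nat \<delta>_alt divide_simps Qs del: of_nat_Suc) (simp add: algebra_simps power2_eq_square)

text \<open>Each passage of E_1 past an F_3 leaves F_2 K_1^{-1}; \<open>brk_Suc\<close> sums these
  contributions to [k]. At k = 0 the truncated \<open>k - 1\<close> is harmless, its coefficient
  being [0] = 0.\<close>

lemma e1_fv: "e1 (fv p k i) = (\<lambda>l a b. \<alpha> * q ^ i * fv p k i l a b + brk (int k) / \<kappa> * fv (Suc p) (k - 1) (i + 2) l a b)"
proof (induction p)
  case 0
  show ?case
  proof (induction k)
    case 0
    show ?case by (auto simp: fv_def basis_def fun_eq_iff brk_0 Q_nat)
  next
    case (Suc k)
    have "e1 (fv 0 (Suc k) i) = (\<lambda>l a b. act Fu3 (e1 (fv 0 k i)) l a b + f2 (k1i (fv 0 k i)) l a b)"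
      by (simp add: fa_ops flip: fv_Suc(2) del: gact.simps)
    also have "\<dots> = (\<lambda>l a b. \<alpha> * q ^ i * fv 0 (Suc k) i l a b + brk (int k) / \<kappa> * (1 / q * fv 1 k (i + 2) l a b)
       + q ^ k / \<kappa> * fv 1 k (i + 2) l a b)"
      unfolding Suc k1i_fv act_linear F3_fv f2_linear fv_Suc
      by (cases k) (simp_all add: brk_zero)
    finally show ?case by (simp add: brk_Suc algebra_simps add_divide_distrib fun_eq_iff del: gact.simps of_nat_Suc)
  qed
next
  case (Suc p)
  have "e1 (fv (Suc p) k i) = f2 (e1 (fv p k i))"
    by (simp only: ef12 flip: fv_Suc(1))
  then show ?case by (simp only: Suc f2_linear fv_Suc)
qed

lemma Gel_fv:
  "act Gel (fv p k i) = (\<lambda>l a b. \<delta>^2 * \<alpha> * q ^ i / q ^ p * fv p (Suc k) i l a b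
     - \<delta> / (\<kappa> * q ^ (1 + k + p)) * fv (Suc p) k (i + 2) l a b + q * \<delta> * \<kappa> / q ^ (3 * (p + k)) * fv (Suc p) k i l a b)"
proof -
  have h1: "brk (int k) / \<kappa> * (1 / q ^ Suc p * fv (Suc p) (Suc (k - 1)) (i + 2) l a b) =
      brk (int k) / (\<kappa> * q ^ Suc p) * fv (Suc p) k (i + 2) l a b" for l a b
    by (cases k) (simp_all add: brk_zero)
  \<comment> \<open>What E_1 leaves while passing F_3^k and the second term of \<open>Gel\<close>
    give multiples of the same vector; here their coefficients are merged.\<close>
  have h2: "\<delta>^2 * (brk (int k) / (\<kappa> * q ^ Suc p)) - \<delta> / q * (q ^ k / (q ^ p * \<kappa>)) = - \<delta> / (\<kappa> * q ^ (1 + k + p))"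
    using q0 \<kappa>0 d0 by (simp add: brk_def Q_nat power_add power2_eq_square field_simps)
  show ?thesis
  proof (intro ext)
    fix l a b
    let ?X = "fv p (Suc k) i l a b" and ?Y = "fv (Suc p) k (i + 2) l a b" and ?Z = "fv (Suc p) k i l a b"
    have "act Gel (fv p k i) l a b = \<delta>^2 * (\<alpha> * q ^ i * (1 / q ^ p * ?X) + brk (int k) / (\<kappa> * q ^ Suc p) * ?Y)
       - \<delta> / q * (q ^ k / (q ^ p * \<kappa>) * ?Y) + q * \<delta> * (\<kappa> / q ^ (3 * (p + k)) * ?Z)"
      unfolding act_Gel e1_fv k1i_fv Kel_fv act_linear F3_fv f2_linear fv_Suc h1 ..
    also have "\<dots> = \<delta>^2 * \<alpha> * q ^ i / q ^ p * ?X + (\<delta>^2 * (brk (int k) / (\<kappa> * q ^ Suc p)) - \<delta> / q * (q ^ k / (q ^ p * \<kappa>))) * ?Y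
       + q * \<delta> * \<kappa> / q ^ (3 * (p + k)) * ?Z"
      by (simp add: algebra_simps)
    also have "\<dots> = \<delta>^2 * \<alpha> * q ^ i / q ^ p * ?X - \<delta> / (\<kappa> * q ^ (1 + k + p)) * ?Y + q * \<delta> * \<kappa> / q ^ (3 * (p + k)) * ?Z"
      unfolding h2 by simp
    finally show "act Gel (fv p k i) l a b = \<delta>^2 * \<alpha> * q ^ i / q ^ p * ?X - \<delta> / (\<kappa> * q ^ (1 + k + p)) * ?Y
       + q * \<delta> * \<kappa> / q ^ (3 * (p + k)) * ?Z" .
  qed
qed

section \<open>The coefficients of u(n,0,1) and their recurrence in n\<close>

lemma qint_brk: "qint q n = brk (int n)"
  using q0 by (simp add: qint_def brk_def \<delta>_def Q_nat power_inverse divide_simps)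

text \<open>A q-multinomial coefficient, see \<open>mult3_eq\<close>.\<close>

definition mult3 :: "nat \<Rightarrow> nat \<Rightarrow> nat \<Rightarrow> complex" where "mult3 n k j = qbinom q n k * qbinom q (n - k) j"

lemma qfact_nz: "qfact q n \<noteq> 0"
  by (auto simp: qfact_def qint_brk brk_0)
lemma qfact_Suc: "qfact q (Suc n) = qfact q n * brk (int (Suc n))"
  by (simp add: qfact_def qint_brk)

lemma mult3_eq: "mult3 n k j = (if k + j \<le> n then qfact q n / (qfact q k * qfact q j * qfact q (n - k - j)) else 0)"
  using qfact_nz by (auto simp: mult3_def qbinom_def)

text \<open>With \<open>r = n + 1 - k - j\<close> this is
  \<open>q^{j+k} [n+1] = [r] + q^{j+n+1} [k] + q^{n+1-k} [j]\<close> times a quotient of q-factorials.\<close>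

lemma mult3_rec:
  "q ^ (j + k) * mult3 (Suc n) k j = mult3 n k j + (if k = 0 then 0 else q ^ (j + n + 1) * mult3 n (k - 1) j)
     + (if j = 0 then 0 else Q (int n + 1 - int k) * mult3 n k (j - 1))"
proof (cases "k + j \<le> Suc n")
  case True
  then obtain r where r: "Suc n = k + j + r" using le_Suc_ex by blast
  define M where "M = qfact q n / (qfact q k * qfact q j * qfact q r)"
  have 1: "mult3 (Suc n) k j = brk (int (Suc n)) * M"
  proof -
    have "Suc n - k - j = r" "k + j \<le> Suc n" using r by simp_all
    then show ?thesis unfolding mult3_eq M_def qfact_Suc by simp
  qed
  have 2: "mult3 n k j = brk (int r) * M"
  proof (cases r)
    case (Suc r')
    then have "n = k + j + r'" using r by simp
    then show ?thesis using Suc qfact_nz[of r'] by (simp add: mult3_eq M_def qfact_Suc brk_0 del: of_nat_Suc)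
  qed (use r in \<open>simp add: mult3_eq brk_zero\<close>)
  have 3: "(if k = 0 then 0 else q ^ (j + n + 1) * mult3 n (k - 1) j) = q ^ (j + n + 1) * brk (int k) * M"
  proof (cases k)
    case (Suc k')
    then have "n = k' + j + r" using r by simp
    then show ?thesis using Suc qfact_nz[of k'] by (simp add: mult3_eq M_def qfact_Suc brk_0 mult.assoc del: of_nat_Suc)
  qed (simp add: brk_zero)
  have 4: "(if j = 0 then 0 else Q (int n + 1 - int k) * mult3 n k (j - 1)) = Q (int n + 1 - int k) * brk (int j) * M"
  proof (cases j)
    case (Suc j')
    then have "n = k + j' + r" using r by simp
    then show ?thesis using Suc qfact_nz[of j'] by (simp add: mult3_eq M_def qfact_Suc brk_0 del: of_nat_Suc)
  qed (simp add: brk_zero)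
  have n: "int (Suc n) = int k + int j + int r" "int n + 1 - int k = int j + int r" using r by simp_all
  have n': "j + n + 1 = j + (k + j + r)" using r by simp
  have "q ^ (j + k) * brk (int (Suc n)) = brk (int r) + q ^ (j + n + 1) * brk (int k) + Q (int n + 1 - int k) * brk (int j)"
    unfolding n n' using q0 d0 by (simp add: brk_def Q_add Q_nat power_add divide_simps) (simp add: algebra_simps)
  then have "q ^ (j + k) * brk (int (Suc n)) * M = (brk (int r) + q ^ (j + n + 1) * brk (int k) + Q (int n + 1 - int k) * brk (int j)) * M"
    by simp
  then show ?thesis unfolding 1 2 3 4 by (simp only: distrib_right mult.assoc)
next
  case False
  then show ?thesis by (cases k; cases j; simp add: mult3_eq)
qed

definition triag :: "nat \<Rightarrow> nat \<Rightarrow> nat \<Rightarrow> int" where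
  "triag n k j = (int k * (2 * int n + 2 * int j + int k - 7)) div 2"

lemma triag_Suc:
  "triag (Suc n) k j = triag n k j + int k" "triag n k (Suc j) = triag n k j + int k"
  "triag n (Suc k) j = triag n k j + (int n + int j + int k - 3)"
proof -
  \<comment> \<open>Adding an even number 2y to the numerator adds y to the quotient whatever the
    parity, so the increments of the exponent follow without showing that the division is
    exact.\<close>
  have 1: "x + 2 * y = z \<Longrightarrow> z div 2 = x div 2 + y" for x y z :: int by auto
  show "triag (Suc n) k j = triag n k j + int k" "triag n k (Suc j) = triag n k j + int k"
    "triag n (Suc k) j = triag n k j + (int n + int j + int k - 3)"
    unfolding triag_def by (rule 1; simp add: algebra_simps)+
qed

definition acf :: "nat \<Rightarrow> nat \<Rightarrow> nat \<Rightarrow> complex" where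
  "acf n k j = (-1) ^ j * \<alpha> ^ k * (q^2 - 1) ^ k * Q (int j * (int n - 3)) * Q (triag n k j)"

lemma acoef_eq: "acoef q \<alpha> n k j = acf n k j * mult3 n k j"
  by (simp add: acoef_def acf_def mult3_def triag_def Q_def mult.assoc)

lemma acf_Suc:
  "acf (Suc n) k j = q ^ (j + k) * acf n k j"
  "acf n k (Suc j) = - Q (int n - 3 + int k) * acf n k j"
  "acf n (Suc k) j = \<alpha> * (q^2 - 1) * Q (int n + int j + int k - 3) * acf n k j"
proof -
  have *: "int j * (int (Suc n) - 3) = int j * (int n - 3) + int j" "int (Suc j) * (int n - 3) = int j * (int n - 3) + (int n - 3)"
    by (simp_all add: algebra_simps)
  show "acf (Suc n) k j = q ^ (j + k) * acf n k j"
    unfolding acf_def triag_Suc * Q_add Q_nat by (simp add: power_add)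
  show "acf n k (Suc j) = - Q (int n - 3 + int k) * acf n k j"
    unfolding acf_def triag_Suc * Q_add by simp
  show "acf n (Suc k) j = \<alpha> * (q^2 - 1) * Q (int n + int j + int k - 3) * acf n k j"
    unfolding acf_def triag_Suc Q_add[of "triag n k j"] by simp
qed

text \<open>Passing from n to n + 1 multiplies the factor \<open>acf\<close> by q^{j+k}, exactly the
  power on the left of \<open>mult3_rec\<close>. The three terms match those of
  \<open>Gel_fv\<close>.\<close>

lemma acoef_rec:
  "acoef q \<alpha> (Suc n) k j = acoef q \<alpha> n k j
     + (if k = 0 then 0 else \<delta> * \<alpha> * Q (2 * int j + 2 * int n + int k - 2) * acoef q \<alpha> n (k - 1) j)
     - (if j = 0 then 0 else Q (2 * int n - 2) * acoef q \<alpha> n k (j - 1))"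
proof -
  have "acoef q \<alpha> (Suc n) k j = acf n k j * (q ^ (j + k) * mult3 (Suc n) k j)"
    by (simp add: acoef_eq acf_Suc)
  moreover have "acf n k j * (if k = 0 then 0 else q ^ (j + n + 1) * mult3 n (k - 1) j)
     = (if k = 0 then 0 else \<delta> * \<alpha> * Q (2 * int j + 2 * int n + int k - 2) * acoef q \<alpha> n (k - 1) j)"
  proof (cases k)
    case (Suc k')
    have "Q (2 * int j + 2 * int n + int k - 2) = Q (int n + int j + int k' - 3) * Q (int (j + n + 2))"
      by (simp add: Suc flip: Q_add) (simp add: algebra_simps)
    moreover have "q * \<delta> = q^2 - 1" using q0 by (simp add: \<delta>_alt)
    ultimately have "\<delta> * Q (2 * int j + 2 * int n + int k - 2) = (q^2 - 1) * Q (int n + int j + int k' - 3) * q ^ (j + n + 1)"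
      by (simp only: Q_nat) (simp add: mult.assoc mult.left_commute)
    then show ?thesis using Suc by (simp add: acoef_eq acf_Suc mult.assoc mult.left_commute)
  qed simp
  moreover have "acf n k j * (if j = 0 then 0 else Q (int n + 1 - int k) * mult3 n k (j - 1))
     = - (if j = 0 then 0 else Q (2 * int n - 2) * acoef q \<alpha> n k (j - 1))"
  proof (cases j)
    case (Suc j')
    have "Q (2 * int n - 2) = Q (int n - 3 + int k) * Q (int n + 1 - int k)" by (simp flip: Q_add)
    then show ?thesis using Suc by (simp add: acoef_eq acf_Suc)
  qed simp
  ultimately show ?thesis unfolding mult3_rec distrib_left by (simp add: acoef_eq)
qed

section \<open>Applying \<open>Gel\<close> to u(n,0,1)\<close>

lemma act_Kinvel_power: "act (Kinvel ^ m) vac = (\<lambda>l a b. 1 / \<kappa> ^ m * vac l a b)"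
proof (induction m)
  case (Suc m)
  have "act Kinvel vac = (\<lambda>l a b. 1 / \<kappa> * vac l a b)"
    by (auto simp: Kinvel_def act_simps power2_eq_square kiop_def fun_eq_iff vac_def Q_0)
  then show ?case by (simp only: act_power Suc act_linear) (simp add: mult.commute)
qed (simp add: act_1)

lemma act_f2_power: "act (Fu I2 ^ n) \<phi> = (f2 ^^ n) \<phi>" and act_F3_power: "act (Fu3 ^ n) \<phi> = (act Fu3 ^^ n) \<phi>"
  by (induction n) (simp_all add: act_1 act_mult act_gelt del: gact.simps)

lemma act_K2_power: "act (Ku I2 ^ n) vac = basis (int n) 0 0"
  using act_Kp[of "int n" vac] by (auto simp: Kp_def vac_basis basis_def fun_eq_iff)

lemma act_uel_term:
  "act (sc z * Fu I2 ^ p * F3 q ^ k * Ku I2 ^ i * Kinvel ^ m) vac = (\<lambda>l a b. z / \<kappa> ^ m * fv p k i l a b)"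
proof -
  have "act (Fu I2 ^ p * (F3 q ^ k * Ku I2 ^ i)) vac = fv p k i"
    by (simp add: act_mult act_K2_power act_f2_power act_F3_power fv_def del: gact.simps)
  moreover have "act (sc z * Fu I2 ^ p * F3 q ^ k * Ku I2 ^ i * Kinvel ^ m) vac
      = act (sc z) (act (Fu I2 ^ p * (F3 q ^ k * Ku I2 ^ i)) (act (Kinvel ^ m) vac))"
    by (simp add: mult.assoc flip: act_mult)
  ultimately show ?thesis by (simp only: act_Kinvel_power act_linear act_sc) simp
qed

lemma acoef_0: "\<not> k + j \<le> n \<Longrightarrow> acoef q \<alpha> n k j = 0"
  by (simp add: acoef_eq mult3_eq)

text \<open>The triangle of indices is enlarged to a square by coefficients that vanish, so that
  shifts of k and j can be made independently of each other.\<close>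

lemma act_uel:
  assumes "N \<ge> n"
  shows "act (uel q \<alpha> n) vac l a b = (\<Sum>k\<le>N. \<Sum>j\<le>N. acoef q \<alpha> n k j / \<kappa> ^ (2 * j + k) * fv (n - k) k (2 * j) l a b)"
proof -
  have "act (uel q \<alpha> n) vac l a b = (\<Sum>k\<in>{0..n}. \<Sum>j\<in>{0..n-k}. acoef q \<alpha> n k j / \<kappa> ^ (2 * j + k) * fv (n - k) k (2 * j) l a b)"
    by (simp add: uel_def act_sum act_uel_term)
  also have "\<dots> = (\<Sum>k\<in>{0..n}. \<Sum>j\<le>N. acoef q \<alpha> n k j / \<kappa> ^ (2 * j + k) * fv (n - k) k (2 * j) l a b)"
    using assms by (intro sum.cong refl sum.mono_neutral_left) (auto simp: acoef_0)
  also have "\<dots> = (\<Sum>k\<le>N. \<Sum>j\<le>N. acoef q \<alpha> n k j / \<kappa> ^ (2 * j + k) * fv (n - k) k (2 * j) l a b)"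
    using assms by (intro sum.mono_neutral_left) (auto simp: acoef_0)
  finally show ?thesis .
qed

lemma shift_sum: "(\<Sum>k\<le>n. f (Suc k)) = (\<Sum>k\<le>Suc n. if k = 0 then 0 else f k :: complex)"
  by (simp add: sum.atMost_Suc_shift del: sum.atMost_Suc)

lemma Gel_uel: "act Gel (act (uel q \<alpha> n) vac) = (\<lambda>l a b. q * \<delta> * \<kappa> / q ^ (3 * n) * act (uel q \<alpha> (Suc n)) vac l a b)"
proof (intro ext)
  fix l a b
  define A where "A = acoef q \<alpha> n"
  define X where "X k j = fv (Suc n - k) k (2 * j) l a b / \<kappa> ^ (2 * j + k)" for k j
  \<comment> \<open>The coefficient contributed by the term F_2 K of \<open>Gel\<close>, common to
    all summands because p + k = n. Once it is factored out, the coefficients are those of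
    \<open>acoef_rec\<close>.\<close>
  define s where "s = q * \<delta> * \<kappa> / q ^ (3 * n)"
  have lin: "act x (\<lambda>l a b. \<Sum>t\<in>S. f t l a b) = (\<lambda>l a b. \<Sum>t\<in>S. act x (f t) l a b)" if "finite S" for S :: "nat set" and f x
    using that by (induction S rule: finite_induct) (simp_all add: act_linear act_zero)
  have U: "act (uel q \<alpha> n) vac = (\<lambda>l a b. \<Sum>k\<le>n. \<Sum>j\<le>n. acoef q \<alpha> n k j / \<kappa> ^ (2 * j + k) * fv (n - k) k (2 * j) l a b)"
    using act_uel[OF order_refl] by (intro ext)
  have "act Gel (act (uel q \<alpha> n) vac) l a b = (\<Sum>k\<le>n. \<Sum>j\<le>n. A k j / \<kappa> ^ (2 * j + k) * act Gel (fv (n - k) k (2 * j)) l a b)"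
    unfolding U A_def by (simp only: lin finite_atMost act_linear)
  also have "\<dots> = (\<Sum>k\<le>n. \<Sum>j\<le>n. s * (\<delta> * \<alpha> * Q (2 * int j + 2 * int n + int (Suc k) - 2) * A k j * X (Suc k) j
      - Q (2 * int n - 2) * A k j * X k (Suc j) + A k j * X k j))"
  proof (intro sum.cong refl)
    fix k j assume "k \<in> {..n}" "j \<in> {..n}"
    then obtain p where p: "n = k + p" using le_Suc_ex by auto
    then have d: "n - k = p" "Suc n - k = Suc p" "Suc n - Suc k = p" by simp_all
    have 1: "s * (\<delta> * \<alpha> * Q (2 * int j + 2 * int n + int (Suc k) - 2) / \<kappa> ^ (2 * j + Suc k)) = \<delta>^2 * \<alpha> * q ^ (2 * j) / q ^ p / \<kappa> ^ (2 * j + k)"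
    proof -
      have "Q (2 * int j + 2 * int n + int (Suc k) - 2) = Q (int (2 * j + 2 * n + k) + - 1)" by (simp add: add.assoc)
      also have "\<dots> = q ^ (2 * j + 2 * n + k) / q" by (simp only: Q_add Q_nat Q_0) simp
      finally have e: "Q (2 * int j + 2 * int n + int (Suc k) - 2) = q ^ (2 * j + 2 * n + k) / q" .
      show ?thesis unfolding e s_def unfolding p using q0 \<kappa>0
        by (simp add: power_add power2_eq_square divide_simps) (simp add: power_mult_distrib power2_eq_square power3_eq_cube power_mult)
    qed
    have 2: "s * (Q (2 * int n - 2) / \<kappa> ^ (2 * Suc j + k)) = \<delta> / (\<kappa> * q ^ (1 + k + p)) / \<kappa> ^ (2 * j + k)"
    proof -
      have "Q (2 * int n - 2) = Q (int (2 * n) + - 2)" by simp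
      also have "\<dots> = q ^ (2 * n) / q^2" by (simp only: Q_add Q_nat Q_0) simp
      finally have e: "Q (2 * int n - 2) = q ^ (2 * n) / q^2" .
      show ?thesis unfolding e s_def unfolding p using q0 \<kappa>0
        by (simp add: power_add power2_eq_square divide_simps) (simp add: power_mult_distrib power2_eq_square power3_eq_cube power_mult)
    qed
    have "A k j / \<kappa> ^ (2 * j + k) * act Gel (fv (n - k) k (2 * j)) l a b =
       A k j * (\<delta>^2 * \<alpha> * q ^ (2 * j) / q ^ p / \<kappa> ^ (2 * j + k)) * fv p (Suc k) (2 * j) l a b
       - A k j * (\<delta> / (\<kappa> * q ^ (1 + k + p)) / \<kappa> ^ (2 * j + k)) * fv (Suc p) k (2 * Suc j) l a b
       + A k j * (s / \<kappa> ^ (2 * j + k)) * fv (Suc p) k (2 * j) l a b"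
      unfolding d Gel_fv s_def p by (simp add: algebra_simps)
    also have "\<dots> = s * (\<delta> * \<alpha> * Q (2 * int j + 2 * int n + int (Suc k) - 2) * A k j * X (Suc k) j
      - Q (2 * int n - 2) * A k j * X k (Suc j) + A k j * X k j)"
      unfolding X_def d 1[symmetric] 2[symmetric] by (simp add: algebra_simps)
    finally show "A k j / \<kappa> ^ (2 * j + k) * act Gel (fv (n - k) k (2 * j)) l a b = \<dots>" .
  qed
  also have "\<dots> = s * ((\<Sum>k\<le>n. \<Sum>j\<le>n. \<delta> * \<alpha> * Q (2 * int j + 2 * int n + int (Suc k) - 2) * A k j * X (Suc k) j)
     - (\<Sum>k\<le>n. \<Sum>j\<le>n. Q (2 * int n - 2) * A k j * X k (Suc j)) + (\<Sum>k\<le>n. \<Sum>j\<le>n. A k j * X k j))"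
    by (simp only: sum_distrib_left[symmetric] sum.distrib sum_subtractf)
  \<comment> \<open>The F_3 term is reindexed by k, the K_2^2 term below by j; vanishing
    coefficients fill all three sums up to the same square.\<close>
  also have "(\<Sum>k\<le>n. \<Sum>j\<le>n. \<delta> * \<alpha> * Q (2 * int j + 2 * int n + int (Suc k) - 2) * A k j * X (Suc k) j)
     = (\<Sum>k\<le>Suc n. \<Sum>j\<le>Suc n. if k = 0 then 0 else \<delta> * \<alpha> * Q (2 * int j + 2 * int n + int k - 2) * A (k - 1) j * X k j)"
  proof -
    have "(\<Sum>k\<le>n. \<Sum>j\<le>n. \<delta> * \<alpha> * Q (2 * int j + 2 * int n + int (Suc k) - 2) * A k j * X (Suc k) j)
      = (\<Sum>k\<le>n. \<Sum>j\<le>Suc n. \<delta> * \<alpha> * Q (2 * int j + 2 * int n + int (Suc k) - 2) * A (Suc k - 1) j * X (Suc k) j)"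
      by (intro sum.cong refl sum.mono_neutral_cong_left) (auto simp: A_def acoef_0)
    also have "\<dots> = (\<Sum>k\<le>Suc n. if k = 0 then 0 else \<Sum>j\<le>Suc n. \<delta> * \<alpha> * Q (2 * int j + 2 * int n + int k - 2) * A (k - 1) j * X k j)"
      by (rule shift_sum)
    finally show ?thesis by (auto intro!: sum.cong simp del: sum.atMost_Suc)
  qed
  also have "(\<Sum>k\<le>n. \<Sum>j\<le>n. Q (2 * int n - 2) * A k j * X k (Suc j))
     = (\<Sum>k\<le>Suc n. \<Sum>j\<le>Suc n. if j = 0 then 0 else Q (2 * int n - 2) * A k (j - 1) * X k j)"
  proof -
    have "(\<Sum>k\<le>n. \<Sum>j\<le>n. Q (2 * int n - 2) * A k j * X k (Suc j))
      = (\<Sum>k\<le>n. \<Sum>j\<le>n. Q (2 * int n - 2) * A k (Suc j - 1) * X k (Suc j))" by simp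
    also have "\<dots> = (\<Sum>k\<le>n. \<Sum>j\<le>Suc n. if j = 0 then 0 else Q (2 * int n - 2) * A k (j - 1) * X k j)"
      by (rule sum.cong[OF refl], rule shift_sum)
    also have "\<dots> = (\<Sum>k\<le>Suc n. \<Sum>j\<le>Suc n. if j = 0 then 0 else Q (2 * int n - 2) * A k (j - 1) * X k j)"
      by (intro sum.mono_neutral_left) (auto simp: A_def acoef_0 intro!: sum.neutral simp del: sum.atMost_Suc)
    finally show ?thesis .
  qed
  also have "(\<Sum>k\<le>n. \<Sum>j\<le>n. A k j * X k j) = (\<Sum>k\<le>Suc n. \<Sum>j\<le>Suc n. A k j * X k j)"
  proof -
    have "(\<Sum>k\<le>n. \<Sum>j\<le>n. A k j * X k j) = (\<Sum>k\<le>n. \<Sum>j\<le>Suc n. A k j * X k j)"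
      by (intro sum.cong refl sum.mono_neutral_left) (auto simp: A_def acoef_0)
    also have "\<dots> = (\<Sum>k\<le>Suc n. \<Sum>j\<le>Suc n. A k j * X k j)"
      by (intro sum.mono_neutral_left) (auto simp: A_def acoef_0 intro!: sum.neutral simp del: sum.atMost_Suc)
    finally show ?thesis .
  qed
  also have "(\<Sum>k\<le>Suc n. \<Sum>j\<le>Suc n. if k = 0 then 0 else \<delta> * \<alpha> * Q (2 * int j + 2 * int n + int k - 2) * A (k - 1) j * X k j)
     - (\<Sum>k\<le>Suc n. \<Sum>j\<le>Suc n. if j = 0 then 0 else Q (2 * int n - 2) * A k (j - 1) * X k j)
     + (\<Sum>k\<le>Suc n. \<Sum>j\<le>Suc n. A k j * X k j) = (\<Sum>k\<le>Suc n. \<Sum>j\<le>Suc n. acoef q \<alpha> (Suc n) k j * X k j)"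
    unfolding sum.distrib[symmetric] sum_subtractf[symmetric] acoef_rec A_def
    by (intro sum.cong refl) (simp add: algebra_simps)
  also have "\<dots> = act (uel q \<alpha> (Suc n)) vac l a b"
    unfolding act_uel[OF order_refl] X_def by simp
  finally show "act Gel (act (uel q \<alpha> n) vac) l a b = q * \<delta> * \<kappa> / q ^ (3 * n) * act (uel q \<alpha> (Suc n)) vac l a b"
    by (simp add: s_def)
qed

text \<open>u(0,0,1) is the generator g_0, and by \<open>Gel_uel\<close> and
  \<open>Gel_basis\<close> the element \<open>Gel\<close> raises n on both sides up to nonzero
  scalars.\<close>

lemma act_uel_basis: "\<exists>z. z \<noteq> 0 \<and> act (uel q \<alpha> n) vac = (\<lambda>l a b. z * basis 0 0 (int n) l a b)"
proof (induction n)
  case 0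
  have "acoef q \<alpha> 0 0 0 = 1" by (simp add: acoef_def qbinom_def qfact_def)
  then have "act (uel q \<alpha> 0) vac = vac"
    using act_uel[of 0 0] by (simp add: fun_eq_iff fv_def vac_basis)
  then show ?case by (intro exI[of _ 1]) (simp add: vac_basis)
next
  case (Suc n)
  then obtain z where z: "z \<noteq> 0" "act (uel q \<alpha> n) vac = (\<lambda>l a b. z * basis 0 0 (int n) l a b)" by blast
  define s where "s = q * \<delta> * \<kappa> / q ^ (3 * n)"
  have s: "s \<noteq> 0" using q0 d0 \<kappa>0 by (simp add: s_def)
  have "z * basis 0 0 (int n + 1) l a b = s * act (uel q \<alpha> (Suc n)) vac l a b" for l a b
    using fun_cong[OF fun_cong[OF fun_cong[OF Gel_uel[of n]]], of l a b] unfolding z(2) act_linear Gel_basis s_def .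
  then have "act (uel q \<alpha> (Suc n)) vac l a b = z / s * basis 0 0 (int (Suc n)) l a b" for l a b
    using s by (simp add: field_simps)
  then show ?case using z(1) s by (intro exI[of _ "z / s"]) auto
qed

end

section \<open>Submodules of \<open>V\<close>\<close>

context whittaker begin

lemma lo_0_iff: "lo (int n) = 0 \<longleftrightarrow> n = 0 \<or> n \<in> crit_set q \<kappa> c"
proof -
  have "Q (3 - 2 * int n) = q ^ 3 / Q (int n) ^ 2"
  proof -
    have "Q (3 - 2 * int n) * Q (int n + int n) = Q (int 3)" by (simp flip: Q_add)
    then have "Q (3 - 2 * int n) * Q (int n) ^ 2 = q ^ 3" unfolding Q_add[of "int n"] Q_nat[of 3] by (simp add: power2_eq_square)
    then show ?thesis using Q0[of "int n"] by (simp add: eq_divide_eq)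
  qed
  moreover have "Q (2 * int n - 3) = Q (int n) ^ 2 / q ^ 3"
  proof -
    have "Q (2 * int n - 3) * Q (int 3) = Q (int n + int n)" by (simp flip: Q_add)
    then have "Q (2 * int n - 3) * q ^ 3 = Q (int n) ^ 2" unfolding Q_add[of "int n"] Q_nat[of 3] by (simp add: power2_eq_square)
    then show ?thesis using q0 by (simp add: eq_divide_eq)
  qed
  ultimately have "hz (int n) = hfun q n \<kappa> c"
    by (simp add: hz_def hfun_def \<delta>_def inverse_eq_divide flip: Q_def)
  then show ?thesis by (auto simp: lo_def brk_0 crit_set_def)
qed

text \<open>In y = q^{2n} the equation h_n = 0 is quadratic, and n is determined by y, so there are
  at most two solutions. This finiteness also gives \<open>Max\<close> and \<open>Min\<close> their
  meaning.\<close>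

lemma crit_set_eq:
  assumes "critical q \<kappa> c"
  shows "crit_set q \<kappa> c = {nminus q \<kappa> c, nplus q \<kappa> c}" "nminus q \<kappa> c \<le> nplus q \<kappa> c" "nminus q \<kappa> c \<ge> 1"
proof -
  let ?C = "crit_set q \<kappa> c"
  let ?y = "\<lambda>n::nat. Q (int n) ^ 2"
  have y_inj: "?y m = ?y n \<longleftrightarrow> m = n" for m n
    using Q_inj[of "int m + int m" "int n + int n"] unfolding Q_add power2_eq_square by auto
  have y: "?y n * ?y n - \<delta>^2 * c * q^3 * \<kappa> * ?y n + (q^3 * \<kappa>)^2 = 0" if "n \<in> ?C" for n
  proof -
    have "n \<noteq> 0" using that by (auto simp: crit_set_def)
    moreover have "lo (int n) = 0" using that lo_0_iff by blast
    ultimately have "hz (int n) = 0" by (simp add: lo_def brk_0)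
    then show ?thesis using q0 \<kappa>0 Q0[of "int n"] unfolding hz_def by (simp add: divide_simps) algebra
  qed
  have sum: "?y m + ?y n = \<delta>^2 * c * q^3 * \<kappa>" if "m \<in> ?C" "n \<in> ?C" "m \<noteq> n" for m n
  proof -
    have "(?y m - ?y n) * (?y m + ?y n - \<delta>^2 * c * q^3 * \<kappa>) = 0" using y[OF that(1)] y[OF that(2)] by algebra
    then show ?thesis using y_inj that(3) by simp
  qed
  have "\<exists>a b. ?C = {a, b}"
  proof -
    obtain a where a: "a \<in> ?C" using assms by (auto simp: critical_def)
    show ?thesis
    proof (cases "?C = {a}")
      case False
      then obtain b where b: "b \<in> ?C" "b \<noteq> a" using a by blast
      \<comment> \<open>Two distinct roots have a fixed sum, so a determines the other root.\<close>
      have "k = b" if "k \<in> ?C" "k \<noteq> a" for k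
        using sum[OF a b(1)] sum[OF a that(1)] that b y_inj[of k b] by (metis add_left_cancel)
      then show ?thesis using a b by blast
    qed blast
  qed
  then obtain a b where ab: "?C = {a, b}" by blast
  then show "?C = {nminus q \<kappa> c, nplus q \<kappa> c}" "nminus q \<kappa> c \<le> nplus q \<kappa> c"
    by (auto simp: nminus_def nplus_def min_def max_def)
  have "nminus q \<kappa> c \<in> ?C" unfolding nminus_def ab by (intro Min_in) auto
  then show "nminus q \<kappa> c \<ge> 1" by (simp add: crit_set_def)
qed

section \<open>Transfer of submodules between V and the model\<close>

abbreviation "cls \<equiv> Vcls q \<alpha> \<kappa> c"

lemma Vcls_eq_iff: "cls x = cls y \<longleftrightarrow> act x vac = act y vac"
proof -
  have "cls x = cls y \<longleftrightarrow> x - y \<in> J"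
  proof
    assume "cls x = cls y"
    moreover have "x \<in> cls x" using J_0 by (simp add: Vcls_def)
    ultimately show "x - y \<in> J" by (simp add: Vcls_def)
  next
    assume *: "x - y \<in> J"
    have "z - x \<in> J \<longleftrightarrow> z - y \<in> J" for z
      using J_add[of "z - x" "x - y"] J_diff[of "z - y" "x - y"] * by auto
    then show "cls x = cls y" by (simp add: Vcls_def)
  qed
  also have "\<dots> \<longleftrightarrow> act x vac = act y vac"
    by (auto simp: act_diff fun_eq_iff simp flip: act_vac_0_iff)
  finally show ?thesis .
qed

definition lift :: "vec set \<Rightarrow> fa set set" where "lift S = {cls x | x. act x vac \<in> S}"

lemma cls_lift: "cls x \<in> lift S \<longleftrightarrow> act x vac \<in> S"
  by (auto simp: lift_def Vcls_eq_iff)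

lemma act_vac_range: "range (\<lambda>x. act x vac) = above 0"
  using orbit_above[of 0] by (simp add: lo_0 vac_basis)

text \<open>Only functions of the form \<open>act x vac\<close> are seen by \<open>lift\<close>; by
  \<open>act_vac_range\<close> these are the elements of \<open>above 0\<close>.\<close>

lemma lift_subset_iff: "S \<subseteq> above 0 \<Longrightarrow> lift S \<subseteq> lift T \<longleftrightarrow> S \<subseteq> T"
proof
  assume S: "S \<subseteq> above 0" and L: "lift S \<subseteq> lift T"
  show "S \<subseteq> T"
  proof
    fix \<phi> assume \<phi>: "\<phi> \<in> S"
    then obtain x where x: "\<phi> = act x vac" using S act_vac_range by blast
    then have "cls x \<in> lift S" using \<phi> cls_lift by blast
    then show "\<phi> \<in> T" using L cls_lift x by blast
  qed
qed (auto simp: lift_def)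

lemma submod_iff: "submod q \<alpha> \<kappa> c T \<longleftrightarrow> (\<exists>S. stable S \<and> T = lift S)"
proof
  assume T: "submod q \<alpha> \<kappa> c T"
  let ?S = "{act x vac | x. cls x \<in> T}"
  have "stable ?S" unfolding stable_def
  proof (intro conjI ballI allI)
    show "?S \<subseteq> above 0" using act_vac_range by blast
    show "(\<lambda>l a b. 0) \<in> ?S" using T unfolding submod_def mem_Collect_eq
      by (intro exI[of _ 0]) (simp add: act_0)
    fix \<phi> \<psi> assume "\<phi> \<in> ?S" "\<psi> \<in> ?S"
    then obtain x y where "\<phi> = act x vac" "cls x \<in> T" "\<psi> = act y vac" "cls y \<in> T" by blast
    then show "(\<lambda>l a b. \<phi> l a b + \<psi> l a b) \<in> ?S" using T unfolding submod_def mem_Collect_eq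
      by (intro exI[of _ "x + y"]) (simp add: act_add_left)
  next
    fix x \<phi> assume "\<phi> \<in> ?S"
    then obtain y where "\<phi> = act y vac" "cls y \<in> T" by blast
    then show "act x \<phi> \<in> ?S" using T unfolding submod_def mem_Collect_eq
      by (intro exI[of _ "x * y"]) (simp add: act_mult)
  qed
  moreover have "T = lift ?S"
  proof
    show "T \<subseteq> lift ?S" using T by (force simp: submod_def Vset_def lift_def)
    show "lift ?S \<subseteq> T" unfolding lift_def by (auto simp flip: Vcls_eq_iff)
  qed
  ultimately show "\<exists>S. stable S \<and> T = lift S" by blast
next
  assume "\<exists>S. stable S \<and> T = lift S"
  then obtain S where S: "stable S" and T: "T = lift S" by blast
  have "T \<subseteq> Vset q \<alpha> \<kappa> c" unfolding T lift_def Vset_def by blast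
  then show "submod q \<alpha> \<kappa> c T" using S unfolding submod_def T cls_lift
    by (auto simp: act_0 act_add_left act_mult stable_add stable_act) (simp add: stable_def)
qed

lemma lift_above_0: "lift (above 0) = Vset q \<alpha> \<kappa> c"
  using act_vac_range by (auto simp: lift_def Vset_def)

lemma lift_zero: "lift {\<lambda>l a b. 0} = zero_submod q \<alpha> \<kappa> c"
  unfolding lift_def zero_submod_def using Vcls_eq_iff[of _ 0] by (auto simp only: act_0 singleton_iff)

text \<open>u(n,0,1) acts on the generator as a nonzero multiple of g_n, so both have the same
  orbit, which is \<open>above n\<close>.\<close>

lemma lift_Wt:
  assumes "n \<in> crit_set q \<kappa> c"
  shows "lift (above (int n)) = Wt q \<alpha> \<kappa> c n"
proof -
  obtain z where z: "z \<noteq> 0" "act (uel q \<alpha> n) vac = (\<lambda>l a b. z * basis 0 0 (int n) l a b)"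
    using act_uel_basis by blast
  have lo: "lo (int n) = 0" using assms lo_0_iff by blast
  have 1: "act (x * uel q \<alpha> n) vac = act (sc z * x) (basis 0 0 (int n))" for x
    unfolding act_mult z(2) act_linear act_sc ..
  have "range (\<lambda>x. act (x * uel q \<alpha> n) vac) = range (\<lambda>x. act x (basis 0 0 (int n)))"
  proof
    show "range (\<lambda>x. act x (basis 0 0 (int n))) \<subseteq> range (\<lambda>x. act (x * uel q \<alpha> n) vac)"
    proof (intro image_subsetI)
      fix x
      have "act x (basis 0 0 (int n)) = act ((sc (1 / z) * x) * uel q \<alpha> n) vac"
        unfolding 1 using z(1) by (simp add: sc_mult_left sc_1)
      then show "act x (basis 0 0 (int n)) \<in> range (\<lambda>x. act (x * uel q \<alpha> n) vac)" by blast
    qed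
  qed (auto simp: 1)
  then have r: "range (\<lambda>x. act (x * uel q \<alpha> n) vac) = above (int n)" using orbit_above[OF lo] by simp
  show ?thesis
  proof
    show "Wt q \<alpha> \<kappa> c n \<subseteq> lift (above (int n))" unfolding Wt_def using r cls_lift by blast
    show "lift (above (int n)) \<subseteq> Wt q \<alpha> \<kappa> c n"
    proof
      fix t assume "t \<in> lift (above (int n))"
      then obtain x where x: "t = cls x" "act x vac \<in> above (int n)" by (auto simp: lift_def)
      then obtain y where "act x vac = act (y * uel q \<alpha> n) vac" using r by blast
      then have "t = cls (y * uel q \<alpha> n)" using x Vcls_eq_iff by blast
      then show "t \<in> Wt q \<alpha> \<kappa> c n" unfolding Wt_def by blast
    qed
  qed
qed

lemma above_subset_iff: "above m \<subseteq> above n \<longleftrightarrow> n \<le> m"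
proof
  assume "above m \<subseteq> above n"
  then have "basis 0 0 m \<in> above n" using basis_above by blast
  moreover have "basis 0 0 m 0 0 m \<noteq> 0" by (simp add: basis_def)
  ultimately show "n \<le> m" unfolding above_def by blast
qed (force simp: above_def)

lemma above_not_zero: "\<not> above n \<subseteq> {\<lambda>l a b. 0}"
proof
  assume "above n \<subseteq> {\<lambda>l a b. 0}"
  then have "basis 0 0 n = (\<lambda>l a b. 0)" using basis_above[of 0 0 n] by blast
  then have "basis 0 0 n 0 0 n = 0" by simp
  then show False by (simp add: basis_def)
qed

lemma stable_zero: "stable {\<lambda>l a b. 0}"
  by (simp add: stable_def above_0 act_zero)

lemma submods:
  "{T. submod q \<alpha> \<kappa> c T} = insert (zero_submod q \<alpha> \<kappa> c) (insert (Vset q \<alpha> \<kappa> c) (Wt q \<alpha> \<kappa> c ` crit_set q \<kappa> c))"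
proof (intro equalityI subsetI)
  fix T assume "T \<in> {T. submod q \<alpha> \<kappa> c T}"
  then obtain S where S: "stable S" and T: "T = lift S" using submod_iff by blast
  show "T \<in> insert (zero_submod q \<alpha> \<kappa> c) (insert (Vset q \<alpha> \<kappa> c) (Wt q \<alpha> \<kappa> c ` crit_set q \<kappa> c))"
  proof (cases "S \<subseteq> {\<lambda>l a b. 0}")
    case True
    then have "S = {\<lambda>l a b. 0}" using S by (auto simp: stable_def)
    then show ?thesis using T lift_zero by simp
  next
    case False
    then obtain \<phi> where \<phi>: "\<phi> \<in> S" "\<phi> \<noteq> (\<lambda>l a b. 0)" by blast
    then obtain l a b where "\<phi> l a b \<noteq> 0" by (auto simp: fun_eq_iff)
    with \<phi>(1) obtain n where n: "lo (int n) = 0" "S = above (int n)" using stable_above[OF S] by blast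
    then show ?thesis using T lift_above_0 lift_Wt by (cases "n = 0") (auto simp: lo_0_iff)
  qed
next
  fix T assume "T \<in> insert (zero_submod q \<alpha> \<kappa> c) (insert (Vset q \<alpha> \<kappa> c) (Wt q \<alpha> \<kappa> c ` crit_set q \<kappa> c))"
  then consider "T = lift {\<lambda>l a b. 0}" | "T = lift (above 0)" | n where "n \<in> crit_set q \<kappa> c" "T = lift (above (int n))"
    using lift_zero lift_above_0 lift_Wt by blast
  then show "T \<in> {T. submod q \<alpha> \<kappa> c T}"
  proof cases
    case 3
    then show ?thesis using above_stable[of "int n"] lo_0_iff submod_iff by auto
  qed (use stable_zero above_stable[of 0] lo_0 submod_iff in auto)
qed

lemma Wt_subset_iff:
  assumes "m \<in> crit_set q \<kappa> c" "n \<in> crit_set q \<kappa> c"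
  shows "Wt q \<alpha> \<kappa> c m \<subseteq> Wt q \<alpha> \<kappa> c n \<longleftrightarrow> n \<le> m"
proof -
  have "above (int m) \<subseteq> above 0" by (simp add: above_subset_iff)
  then show ?thesis using assms by (simp add: lift_subset_iff above_subset_iff flip: lift_Wt)
qed

lemma Wt_strict:
  assumes "n \<in> crit_set q \<kappa> c"
  shows "zero_submod q \<alpha> \<kappa> c \<subset> Wt q \<alpha> \<kappa> c n" "Wt q \<alpha> \<kappa> c n \<subset> Vset q \<alpha> \<kappa> c"
proof -
  have n: "n \<ge> 1" using assms by (simp add: crit_set_def)
  have sub: "above (int n) \<subseteq> above 0" by (simp add: above_subset_iff)
  show "zero_submod q \<alpha> \<kappa> c \<subset> Wt q \<alpha> \<kappa> c n"
    using sub assms above_not_zero by (simp add: less_le_not_le lift_subset_iff above_0 flip: lift_Wt lift_zero)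
  show "Wt q \<alpha> \<kappa> c n \<subset> Vset q \<alpha> \<kappa> c"
    using n sub assms by (simp add: less_le_not_le lift_subset_iff above_subset_iff flip: lift_Wt lift_above_0)
qed

end

theorem theorem5p6:
  fixes q \<alpha> \<kappa> c :: complex
  assumes q0: "q \<noteq> 0"
    and qroot: "\<forall>m::nat. m \<ge> 1 \<longrightarrow> q ^ m \<noteq> 1"
    and \<alpha>0: "\<alpha> \<noteq> 0"
    and crit: "critical q \<kappa> c"
  shows "maximal_submod q \<alpha> \<kappa> c (Wminus q \<alpha> \<kappa> c)
    \<and> minimal_submod q \<alpha> \<kappa> c (Wplus q \<alpha> \<kappa> c)
    \<and> (nplus q \<kappa> c = nminus q \<kappa> c \<longrightarrow>
          Wplus q \<alpha> \<kappa> c = Wminus q \<alpha> \<kappa> c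
        \<and> zero_submod q \<alpha> \<kappa> c \<subset> Wplus q \<alpha> \<kappa> c \<and> Wplus q \<alpha> \<kappa> c \<subset> Vset q \<alpha> \<kappa> c
        \<and> {T. submod q \<alpha> \<kappa> c T} = {zero_submod q \<alpha> \<kappa> c, Wplus q \<alpha> \<kappa> c, Vset q \<alpha> \<kappa> c})
    \<and> (nminus q \<kappa> c < nplus q \<kappa> c \<longrightarrow>
          zero_submod q \<alpha> \<kappa> c \<subset> Wplus q \<alpha> \<kappa> c \<and> Wplus q \<alpha> \<kappa> c \<subset> Wminus q \<alpha> \<kappa> c
        \<and> Wminus q \<alpha> \<kappa> c \<subset> Vset q \<alpha> \<kappa> c
        \<and> {T. submod q \<alpha> \<kappa> c T}
            = {zero_submod q \<alpha> \<kappa> c, Wplus q \<alpha> \<kappa> c, Wminus q \<alpha> \<kappa> c, Vset q \<alpha> \<kappa> c})"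
proof -
  interpret whittaker q \<alpha> \<kappa> c
    using assms by unfold_locales (auto simp: critical_def)
  let ?Z = "zero_submod q \<alpha> \<kappa> c" and ?V = "Vset q \<alpha> \<kappa> c"
  let ?P = "Wplus q \<alpha> \<kappa> c" and ?M = "Wminus q \<alpha> \<kappa> c"
  note C = crit_set_eq[OF crit]
  have in_crit: "nminus q \<kappa> c \<in> crit_set q \<kappa> c" "nplus q \<kappa> c \<in> crit_set q \<kappa> c" using C(1) by auto
  \<comment> \<open>One list serves both cases: for n_+ = n_- two of its entries coincide. As its
    entries form a chain, the uniqueness of the composition series is contained in it.\<close>
  have sub: "{T. submod q \<alpha> \<kappa> c T} = {?Z, ?P, ?M, ?V}"
    unfolding submods Wplus_def Wminus_def by (subst C(1)) auto
  then have sm: "submod q \<alpha> \<kappa> c T \<longleftrightarrow> T = ?Z \<or> T = ?P \<or> T = ?M \<or> T = ?V" for T by blast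
  have strict: "?Z \<subset> ?P" "?Z \<subset> ?M" "?P \<subset> ?V" "?M \<subset> ?V"
    using Wt_strict in_crit by (simp_all add: Wplus_def Wminus_def)
  \<comment> \<open>A larger n gives a smaller submodule, so n_+ belongs to the lower step of the
    chain.\<close>
  have PM: "?P \<subseteq> ?M" using Wt_subset_iff in_crit C(2) by (simp add: Wplus_def Wminus_def)
  have MP: "?M \<subseteq> ?P \<longleftrightarrow> nplus q \<kappa> c = nminus q \<kappa> c"
    using Wt_subset_iff in_crit C(2) by (auto simp add: Wplus_def Wminus_def)
  have "maximal_submod q \<alpha> \<kappa> c ?M"
    unfolding maximal_submod_def sm using strict PM by blast
  moreover have "minimal_submod q \<alpha> \<kappa> c ?P"
    unfolding minimal_submod_def sm using strict PM by blast
  moreover have "?P = ?M" if "nplus q \<kappa> c = nminus q \<kappa> c" using that PM MP by blast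
  moreover have "?P \<subset> ?M" if "nminus q \<kappa> c < nplus q \<kappa> c" using that PM MP by auto
  ultimately show ?thesis using sub strict by auto
qed

end
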